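(* Let $\mu$ be a critical offspring distribution (a probability measure on $\{0,1,2,\dots\}$ with mean $1$) with finite non-zero variance. Let $T_\infty$ be a $\mu$-Galton--Watson plane tree conditioned to survive forever and let $\mathscr{C}_\infty=\mathsf{Causal}(T_\infty)$ be the associated causal map. Then $\mathscr{C}_\infty$ is recurrent (for simple random walk) almost surely.
   Context: For a locally finite plane tree $\tau$ with root $\rho$, the height of a vertex is its distance to $\rho$ in $\tau$; $[\tau]_k$ is the (plane) subtree spanned by the vertices of height at most $k$, and $\partial[\tau]_k$ is the set of vertices of height exactly $k$. The plane structure gives a cyclic left-to-right ordering of the vertices of each level; $\mathsf{Causal}(\tau)$ is the graph (planar map) obtained from $\tau$ by adding, for every level, the "horizontal" edges linking successive vertices in the cyclic ordering of that level (so a level with $k$ vertices carries $k$ horizontal edges: a loop if $k=1$, two parallel edges if $k=2$). For critical $\mu$ with $\mu\ne\delta_1$, let $T$ be a $\mu$-Galton--Watson plane tree. The $\mu$-Galton--Watson tree conditioned to survive forever is the random infinite, locally finite plane tree $T_\infty$ whose law is characterized by $\mathbb{E}[F([T_\infty]_n)]=\mathbb{E}[F([T]_n)\,\#\partial[T]_n]$ for every $n\ge 0$ and every nonnegative function $F$ on finite plane trees. *)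

theory Defs
  imports
    "HOL-Probability.Probability"
    "HOL-Library.List_Lexorder"
    "Graph_Theory.Graph_Theory"
begin

text \<open>
  Ulam--Harris encoding: a vertex is the word of child indices (counted from 0, left to right)
  read along the path from the root \<^term>\<open>[] :: nat list\<close>. The height of a vertex is the
  length of this word, and the left-to-right order of a level is the lexicographic order.
\<close>

type_synonym vertex = "nat list"

definition plane_tree :: "vertex set \<Rightarrow> bool" where
  "plane_tree t \<longleftrightarrow>
     [] \<in> t \<and>
     (\<forall>u i. u @ [i] \<in> t \<longrightarrow> u \<in> t \<and> (\<forall>j<i. u @ [j] \<in> t)) \<and>
     (\<forall>u\<in>t. finite {i. u @ [i] \<in> t})"

definition truncate_tree :: "nat \<Rightarrow> vertex set \<Rightarrow> vertex set" where
  "truncate_tree k t = {u \<in> t. length u \<le> k}"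

definition level :: "vertex set \<Rightarrow> nat \<Rightarrow> vertex set" where
  "level t k = {u \<in> t. length u = k}"

definition plane_tree_space :: "vertex set measure" where
  "plane_tree_space =
     sigma {t. plane_tree t} {{t. plane_tree t \<and> truncate_tree k t = s} | k s. True}"

text \<open>The tree in which the vertex \<open>u\<close>, if present, has \<open>\<xi> u\<close> children.\<close>

definition tree_of_offspring :: "(vertex \<Rightarrow> nat) \<Rightarrow> vertex set" where
  "tree_of_offspring \<xi> = {u. \<forall>k<length u. u ! k < \<xi> (take k u)}"

definition galton_watson :: "nat pmf \<Rightarrow> vertex set measure" where
  "galton_watson \<mu> =
     distr (\<Pi>\<^sub>M u\<in>UNIV. measure_pmf \<mu>) plane_tree_space tree_of_offspring"

text \<open>
  The law of \<open>T\<close> is prescribed through its truncations; the arguments fed to \<open>F\<close> are always finite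
  plane trees. The almost sure infiniteness also follows from the identity.
\<close>

definition gw_conditioned_to_survive ::
  "nat pmf \<Rightarrow> 'w measure \<Rightarrow> ('w \<Rightarrow> vertex set) \<Rightarrow> bool" where
  "gw_conditioned_to_survive \<mu> M T \<longleftrightarrow>
     T \<in> measurable M plane_tree_space \<and>
     (AE \<omega> in M. infinite (T \<omega>)) \<and>
     (\<forall>n. \<forall>F :: vertex set \<Rightarrow> ennreal.
        (\<integral>\<^sup>+\<omega>. F (truncate_tree n (T \<omega>)) \<partial>M) =
        (\<integral>\<^sup>+t. F (truncate_tree n t) * of_nat (card (level t n)) \<partial>galton_watson \<mu>))"

text \<open>The successor is cyclic: the rightmost vertex of a level is followed by the leftmost one.\<close>

definition next_in_level :: "vertex set \<Rightarrow> vertex \<Rightarrow> vertex" where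
  "next_in_level t u =
     (let L = level t (length u); R = {v \<in> L. u < v}
      in if R = {} then Min L else Min R)"

text \<open>
  \<open>Tree_edge u\<close> joins \<open>u\<close> to its parent and \<open>Horizontal_edge u\<close> joins \<open>u\<close> to its cyclic successor,
  so a level with one vertex carries a loop and a level with two vertices two parallel edges.
\<close>

datatype causal_edge = Tree_edge vertex | Horizontal_edge vertex

definition causal_edges :: "vertex set \<Rightarrow> causal_edge set" where
  "causal_edges t = Tree_edge ` (t - {[]}) \<union> Horizontal_edge ` t"

fun edge_source :: "causal_edge \<Rightarrow> vertex" where
  "edge_source (Tree_edge u) = u"
| "edge_source (Horizontal_edge u) = u"

fun edge_target :: "vertex set \<Rightarrow> causal_edge \<Rightarrow> vertex" where
  "edge_target t (Tree_edge u) = butlast u"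
| "edge_target t (Horizontal_edge u) = next_in_level t u"

text \<open>
  The undirected multigraph is represented by its oriented edges: every edge contributes two
  opposite arcs, the flag telling whether it is traversed from source to target. Hence a loop
  counts twice in the degree of its vertex.
\<close>

definition Causal :: "vertex set \<Rightarrow> (vertex, causal_edge \<times> bool) pre_digraph" where
  "Causal t =
     \<lparr> verts = t,
       arcs = causal_edges t \<times> UNIV,
       tail = (\<lambda>(e, fwd). if fwd then edge_source e else edge_target t e),
       head = (\<lambda>(e, fwd). if fwd then edge_target t e else edge_source e) \<rparr>"

text \<open>
  The walk crosses a uniformly chosen outgoing arc; this is meaningful when every vertex has
  finitely many, and at least one, outgoing arcs.
\<close>

definition srw_step :: "('a, 'b) pre_digraph \<Rightarrow> 'a \<Rightarrow> 'a pmf" where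
  "srw_step G x = map_pmf (head G) (pmf_of_set (out_arcs G x))"

definition srw_kernel :: "('a, 'b) pre_digraph \<Rightarrow> 'a \<Rightarrow> nat \<Rightarrow> (nat \<Rightarrow> 'a) \<Rightarrow> 'a measure" where
  "srw_kernel G v n \<omega> =
     measure_pmf (case n of 0 \<Rightarrow> return_pmf v | Suc m \<Rightarrow> srw_step G (\<omega> m))"

text \<open>The law of the whole trajectory started at \<open>v\<close>, from the Ionescu-Tulcea theorem.\<close>

definition simple_random_walk :: "('a, 'b) pre_digraph \<Rightarrow> 'a \<Rightarrow> (nat \<Rightarrow> 'a) measure" where
  "simple_random_walk G v =
     projective_family.lim UNIV
       (Ionescu_Tulcea.CI (srw_kernel G v) (\<lambda>_. count_space UNIV)) (\<lambda>_. count_space UNIV)"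

definition recurrent :: "('a, 'b) pre_digraph \<Rightarrow> bool" where
  "recurrent G \<longleftrightarrow>
     (\<forall>v\<in>verts G. AE \<omega> in simple_random_walk G v. \<exists>n\<ge>1. \<omega> n = v)"

lemma plane_tree_tree_of_offspring: "plane_tree (tree_of_offspring \<xi>)"
  unfolding plane_tree_def
proof (intro conjI allI impI ballI)
  show "[] \<in> tree_of_offspring \<xi>"
    by (simp add: tree_of_offspring_def)
next
  fix u i assume *: "u @ [i] \<in> tree_of_offspring \<xi>"
  show "u \<in> tree_of_offspring \<xi>"
    unfolding tree_of_offspring_def
  proof (clarify)
    fix k assume "k < length u"
    with * show "u ! k < \<xi> (take k u)"
      by (auto simp: tree_of_offspring_def nth_append dest!: spec[of _ k])
  qed
  fix j assume "j < i"
  with * show "u @ [j] \<in> tree_of_offspring \<xi>"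
    by (force simp: tree_of_offspring_def nth_append less_Suc_eq)
next
  fix u
  have "{i. u @ [i] \<in> tree_of_offspring \<xi>} \<subseteq> {..<\<xi> u}"
    by (auto simp: tree_of_offspring_def)
  then show "finite {i. u @ [i] \<in> tree_of_offspring \<xi>}"
    by (rule finite_subset) simp
qed

lemma measurable_tree_of_offspring:
  "tree_of_offspring \<in> measurable (\<Pi>\<^sub>M u\<in>UNIV. measure_pmf \<mu>) plane_tree_space"
  unfolding plane_tree_space_def
proof (rule measurable_measure_of)
  show "{{t. plane_tree t \<and> truncate_tree k t = s} | k s. True} \<subseteq> Pow {t. plane_tree t}"
    by auto
  show "tree_of_offspring \<in> space (\<Pi>\<^sub>M u\<in>UNIV. measure_pmf \<mu>) \<rightarrow> {t. plane_tree t}"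
    by (auto intro: plane_tree_tree_of_offspring)
next
  fix A assume "A \<in> {{t. plane_tree t \<and> truncate_tree k t = s} | k s. True}"
  then obtain k s where A: "A = {t. plane_tree t \<and> truncate_tree k t = s}" by auto
  have "tree_of_offspring -` A \<inter> space (\<Pi>\<^sub>M u\<in>UNIV. measure_pmf \<mu>) =
    {\<xi> \<in> space (\<Pi>\<^sub>M u\<in>UNIV. measure_pmf \<mu>). \<forall>u.
       ((\<forall>k<length u. u ! k < \<xi> (take k u)) \<and> length u \<le> k) = (u \<in> s)}"
    by (simp add: A plane_tree_tree_of_offspring vimage_def Int_def conj_commute)
      (auto simp: truncate_tree_def tree_of_offspring_def set_eq_iff)
  also have "\<dots> \<in> sets (\<Pi>\<^sub>M u\<in>UNIV. measure_pmf \<mu>)"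
    by measurable
  finally show "tree_of_offspring -` A \<inter> space (\<Pi>\<^sub>M u\<in>UNIV. measure_pmf \<mu>)
      \<in> sets (\<Pi>\<^sub>M u\<in>UNIV. measure_pmf \<mu>)" .
qed

lemma finite_level:
  assumes "plane_tree t"
  shows "finite (level t k)"
proof (induction k)
  case 0
  have "level t 0 \<subseteq> {[]}" by (auto simp: level_def)
  then show ?case by (rule finite_subset) simp
next
  case (Suc k)
  have "level t (Suc k) \<subseteq> (\<Union>u\<in>level t k. (\<lambda>i. u @ [i]) ` {i. u @ [i] \<in> t})"
  proof
    fix w assume w: "w \<in> level t (Suc k)"
    then have "w \<noteq> []" by (auto simp: level_def)
    then obtain u i where "w = u @ [i]" by (metis append_butlast_last_id)
    moreover have "u \<in> t"
      using w assms \<open>w = u @ [i]\<close> unfolding plane_tree_def level_def by blast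
    ultimately show "w \<in> (\<Union>u\<in>level t k. (\<lambda>i. u @ [i]) ` {i. u @ [i] \<in> t})"
      using w by (auto simp: level_def)
  qed
  moreover have "finite {i. u @ [i] \<in> t}" if "u \<in> level t k" for u
    using that assms by (simp add: level_def plane_tree_def)
  then have "finite (\<Union>u\<in>level t k. (\<lambda>i. u @ [i]) ` {i. u @ [i] \<in> t})"
    using Suc by simp
  ultimately show ?case by (rule finite_subset)
qed

lemma next_in_level_in_level:
  assumes "plane_tree t" "u \<in> t"
  shows "next_in_level t u \<in> level t (length u)"
proof -
  define L where "L = level t (length u)"
  have L: "finite L" "u \<in> L"
    using finite_level[OF assms(1)] assms(2) by (auto simp: L_def level_def)
  have "(if {v \<in> L. u < v} = {} then Min L else Min {v \<in> L. u < v}) \<in> L"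
  proof (cases "{v \<in> L. u < v} = {}")
    case True
    moreover have "Min L \<in> L" using L by (intro Min_in) auto
    ultimately show ?thesis using True by simp
  next
    case False
    then have "Min {v \<in> L. u < v} \<in> {v \<in> L. u < v}" using L by (intro Min_in) auto
    with False show ?thesis by (simp only: if_False) blast
  qed
  then show ?thesis by (simp only: next_in_level_def L_def Let_def)
qed

lemma butlast_in_plane_tree:
  assumes "plane_tree t" "u \<in> t"
  shows "butlast u \<in> t"
proof (cases u rule: rev_cases)
  case (snoc w i)
  then show ?thesis using assms by (auto simp: plane_tree_def)
qed (use assms in simp)

lemma wf_digraph_Causal:
  assumes "plane_tree t"
  shows "wf_digraph (Causal t)"
proof
  fix e assume "e \<in> arcs (Causal t)"
  then show "tail (Causal t) e \<in> verts (Causal t)" "head (Causal t) e \<in> verts (Causal t)"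
    using next_in_level_in_level[OF assms] butlast_in_plane_tree[OF assms]
    by (cases e; cases "fst e"; cases "snd e"; auto simp: Causal_def causal_edges_def level_def)+
qed

lemma symmetric_Causal: "symmetric (Causal t)"
  unfolding symmetric_conv
proof
  fix e assume "e \<in> arcs (Causal t)"
  then show "\<exists>e'\<in>arcs (Causal t). tail (Causal t) e = head (Causal t) e' \<and>
      head (Causal t) e = tail (Causal t) e'"
    by (intro bexI[of _ "(fst e, \<not> snd e)"]) (auto simp: Causal_def)
qed

lemma finite_out_arcs_Causal:
  assumes "plane_tree t"
  shows "finite (out_arcs (Causal t) u)"
proof -
  let ?S = "level t (length u) \<union> level t (Suc (length u))"
  have "out_arcs (Causal t) u \<subseteq> (Tree_edge ` ?S \<union> Horizontal_edge ` ?S) \<times> UNIV"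
    using next_in_level_in_level[OF assms]
    by (auto simp: out_arcs_def Causal_def causal_edges_def level_def split: if_splits)
  then show ?thesis
    by (rule finite_subset) (use finite_level[OF assms] in auto)
qed

lemma out_arcs_Causal_nonempty: "u \<in> t \<Longrightarrow> out_arcs (Causal t) u \<noteq> {}"
  by (auto simp: out_arcs_def Causal_def causal_edges_def
      intro!: exI[of _ "Horizontal_edge u"] exI[of _ True])

lemma Ionescu_Tulcea_srw:
  fixes G :: "('a, 'b) pre_digraph"
  shows "Ionescu_Tulcea (srw_kernel G v) (\<lambda>_. count_space UNIV)"
proof (rule Ionescu_Tulcea.intro)
  fix i :: nat
  show "srw_kernel G v i \<in>
    measurable (PiM {0..<i} (\<lambda>_. count_space UNIV)) (subprob_algebra (count_space UNIV))"
  proof (cases i)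
    case 0
    then have "srw_kernel G v i = (\<lambda>_. measure_pmf (return_pmf v))"
      by (simp add: srw_kernel_def fun_eq_iff)
    then show ?thesis
      by (simp add: measure_pmf_in_subprob_algebra)
  next
    case (Suc m)
    have "(\<lambda>\<omega>. measure_pmf (srw_step G (\<omega> m))) \<in>
      measurable (PiM {0..<i} (\<lambda>_. count_space UNIV)) (subprob_algebra (count_space UNIV))"
    proof (rule measurable_compose[where f = "\<lambda>\<omega>. \<omega> m" and g = "\<lambda>x. measure_pmf (srw_step G x)"])
      show "(\<lambda>\<omega>. \<omega> m) \<in> measurable (PiM {0..<i} (\<lambda>_. count_space UNIV)) (count_space UNIV)"
        by (rule measurable_component_singleton) (simp add: Suc)
    qed (simp add: measure_pmf_in_subprob_algebra)
    with Suc show ?thesis by (simp add: srw_kernel_def[abs_def])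
  qed
next
  fix i :: nat and x :: "nat \<Rightarrow> 'a"
  show "prob_space (srw_kernel G v i x)"
    unfolding srw_kernel_def by (rule prob_space_measure_pmf)
qed

lemma simple_random_walk_cylinder:
  fixes G :: "('a, 'b) pre_digraph"
  shows "emeasure (simple_random_walk G v) {\<omega>. \<forall>i\<le>n. \<omega> i = x i} =
     ennreal (indicator {v} (x 0) * (\<Prod>i<n. pmf (srw_step G (x i)) (x (Suc i))))"
proof -
  let ?P = "srw_kernel G v" and ?M = "\<lambda>_::nat. count_space (UNIV :: 'a set)"
  interpret IT: Ionescu_Tulcea ?P ?M by (rule Ionescu_Tulcea_srw)
  define X where "X n = {restrict x {0..<n}}" for n
  have X_PiE: "X n = PiE {0..<n} (\<lambda>i. {x i})" for n
    unfolding X_def by (auto simp: PiE_iff extensional_def fun_eq_iff restrict_def)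
  have X_sets [measurable]: "X n \<in> sets (PiM {0..<n} ?M)" for n
    unfolding X_PiE by (rule sets_PiM_I_finite) auto
  have und: "(\<lambda>_. undefined) \<in> space (PiM {0..<0} ?M)"
    by (simp add: space_PiM)
  have step: "emeasure (IT.C 0 (Suc n) (\<lambda>_. undefined)) (X (Suc n)) =
      (\<integral>\<^sup>+\<omega>. indicator (X n) \<omega> * emeasure (?P n x) {x n} \<partial>IT.C 0 n (\<lambda>_. undefined))" for n
  proof -
    have "emeasure (IT.C 0 (Suc n) (\<lambda>_. undefined)) (X (Suc n)) =
        (\<integral>\<^sup>+\<omega>. emeasure (IT.eP n \<omega>) (X (Suc n)) \<partial>IT.C 0 n (\<lambda>_. undefined))"
    proof -
      have "IT.eP n \<in> measurable (IT.C 0 n (\<lambda>_. undefined)) (subprob_algebra (PiM {0..<Suc n} ?M))"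
        using IT.measurable_eP[of n] IT.sets_C[OF und, of n]
        by (simp cong: measurable_cong_sets)
      moreover have "space (IT.C 0 n (\<lambda>_. undefined)) \<noteq> {}"
        using IT.prob_space_C[OF und, of n] by (rule prob_space.not_empty)
      ultimately show ?thesis
        by (simp add: emeasure_bind[OF _ _ X_sets])
    qed
    also have "\<dots> = (\<integral>\<^sup>+\<omega>. indicator (X n) \<omega> * emeasure (?P n x) {x n}
        \<partial>IT.C 0 n (\<lambda>_. undefined))"
    proof (rule nn_integral_cong)
      fix \<omega> assume "\<omega> \<in> space (IT.C 0 n (\<lambda>_. undefined))"
      then have \<omega>: "\<omega> \<in> space (PiM {0..<n} ?M)"
        using IT.space_C[OF und, of n] by simp
      then have ext: "\<omega> \<in> extensional {0..<n}"
        by (auto simp: space_PiM PiE_iff)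
      have eq: "emeasure (IT.eP n \<omega>) (X (Suc n)) =
          emeasure (?P n \<omega>) (fun_upd \<omega> n -` X (Suc n))"
        using IT.emeasure_eP[OF \<omega> X_sets] by simp
      show "emeasure (IT.eP n \<omega>) (X (Suc n)) = indicator (X n) \<omega> * emeasure (?P n x) {x n}"
      proof (cases "\<omega> \<in> X n")
        case True
        then have \<omega>_eq: "\<omega> = restrict x {0..<n}" by (simp add: X_def)
        have "(fun_upd \<omega> n y = restrict x {0..<Suc n}) = (y = x n)" for y
        proof
          assume "fun_upd \<omega> n y = restrict x {0..<Suc n}"
          from fun_cong[OF this, of n] show "y = x n" by simp
        qed (auto simp: \<omega>_eq fun_eq_iff)
        then have "fun_upd \<omega> n -` X (Suc n) = {x n}"
          by (auto simp: X_def)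
        moreover have "?P n \<omega> = ?P n x"
          by (cases n) (simp_all add: srw_kernel_def \<omega>_eq)
        ultimately show ?thesis using True eq by simp
      next
        case False
        have "fun_upd \<omega> n -` X (Suc n) = {}"
        proof (rule ccontr)
          assume "fun_upd \<omega> n -` X (Suc n) \<noteq> {}"
          then obtain y where y: "fun_upd \<omega> n y = restrict x {0..<Suc n}"
            by (auto simp: X_def)
          have "\<omega> i = restrict x {0..<n} i" for i
            using fun_cong[OF y, of i] ext by (cases "i < n") (auto simp: extensional_def)
          then have "\<omega> \<in> X n" by (auto simp: X_def)
          with False show False by simp
        qed
        then show ?thesis using False eq by simp
      qed
    qed
    finally show ?thesis .
  qed
  have rec: "emeasure (IT.C 0 (Suc n) (\<lambda>_. undefined)) (X (Suc n)) =
      emeasure (IT.C 0 n (\<lambda>_. undefined)) (X n) * emeasure (?P n x) {x n}" for n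
  proof -
    have "X n \<in> sets (IT.C 0 n (\<lambda>_. undefined))"
      using IT.sets_C[OF und, of n] X_sets[of n] by simp
    then show ?thesis
      unfolding step by (subst nn_integral_multc) auto
  qed
  have C: "emeasure (IT.C 0 (Suc n) (\<lambda>_. undefined)) (X (Suc n)) =
      ennreal (indicator {v} (x 0) * (\<Prod>i<n. pmf (srw_step G (x i)) (x (Suc i))))"
  proof (induction n)
    case 0
    have "emeasure (IT.C 0 0 (\<lambda>_. undefined)) (X 0) = 1"
      using X_sets[of 0] by (simp add: X_def restrict_def)
    then show ?case
      unfolding rec[of 0] by (simp add: srw_kernel_def emeasure_pmf_single pmf_return indicator_def)
  next
    case (Suc n)
    show ?case
      unfolding rec[of "Suc n"] Suc
      by (simp add: srw_kernel_def emeasure_pmf_single ennreal_mult' prod_nonneg mult.assoc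
          flip: ennreal_mult')
  qed
  have "{\<omega>. \<forall>i\<le>n. \<omega> i = x i} = IT.PF.emb UNIV {0..<Suc n} (X (Suc n))"
    by (auto simp: prod_emb_def X_PiE PiE_iff less_Suc_eq_le)
  then have "emeasure (simple_random_walk G v) {\<omega>. \<forall>i\<le>n. \<omega> i = x i} =
      emeasure (IT.CI {0..<Suc n}) (X (Suc n))"
    using IT.lim[OF _ X_sets[of "Suc n"]] by (simp add: simple_random_walk_def)
  also have "\<dots> = emeasure (IT.C 0 (Suc n) (\<lambda>_. undefined)) (X (Suc n))"
    using IT.emeasure_CI[OF order.refl X_sets[of "Suc n"]]
    by (simp add: prod_emb_id[OF sets.sets_into_space[OF X_sets, unfolded space_PiM]])
  finally show ?thesis using C by simp
qed

end

theory Submission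
  imports Defs
begin

text \<open>
  Let \<open>Z n\<close> be the number of vertices at height \<open>n\<close> of the tree conditioned to survive. The proof has a
  deterministic half, which reduces recurrence to the divergence of the sum of \<open>1 / Z n\<close>, and a
  probabilistic half, which shows that this sum diverges almost surely.

  For the deterministic half, horizontal edges join vertices of equal height, and exactly \<open>Z (n + 1)\<close>
  edges join height \<open>n\<close> to height \<open>n + 1\<close>. These sets of edges are disjoint cutsets, and the criterion
  of Nash-Williams gives recurrence as soon as the sum of their inverse sizes diverges
  (\<open>recurrent_if_sum_inverse_layers_diverges\<close>). The criterion is proved through a test function that
  depends on the height only. The link between the escape probability at a vertex and the Dirichlet
  energy of test functions is \<open>flux_le_energy\<close>. It combines a summation by parts with Picone's
  inequality, applied to the positive superharmonic function obtained from the probabilities of never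
  hitting that vertex.

  For the probabilistic half, the law of the conditioned tree is size-biased by the level size, so
  the mean of \<open>Z n\<close> is the second moment of the size of generation \<open>n\<close> of the unconditioned critical
  tree. That second moment grows at most linearly in \<open>n\<close>
  (\<open>nn_integral_card_generation_sq\<close>); this is where the finite variance enters. A linear bound on the means
  already forces the sum of \<open>1 / Z n\<close> to diverge almost surely, by the Cauchy-Schwarz inequality and
  the divergence of the harmonic series (\<open>AE_not_summable_inverse\<close>).
\<close>

section \<open>Superharmonic functions and the Dirichlet energy\<close>

text \<open>
  This is Picone's inequality on a single edge: the difference of the two sides is a square divided
  by \<open>h k\<close>. Used below with \<open>h\<close>, \<open>k\<close> the values of a positive superharmonic function at the
  endpoints, it compares the increments of that function with those of a test function.
\<close>

lemma picone_inequality: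
  fixes a b h k :: real
  assumes "h > 0" "k > 0"
  shows "(a\<^sup>2 / h - b\<^sup>2 / k) * (h - k) \<le> (a - b)\<^sup>2"
proof -
  have "(a - b)\<^sup>2 - (a\<^sup>2 / h - b\<^sup>2 / k) * (h - k) = (a * k - b * h)\<^sup>2 / (h * k)"
    using assms by (simp add: field_simps power2_eq_square)
  also have "\<dots> \<ge> 0" using assms by simp
  finally show ?thesis by simp
qed

text \<open>
  Summation by parts: reversing all arcs pairs the two orientations of each edge, which turns the
  left-hand side into the sum over arcs of the left-hand side of Picone's inequality with test
  function \<open>f\<close>. Dividing \<open>f\<^sup>2\<close> by \<open>h\<close> removes \<open>h\<close>, whose own energy may be infinite, from
  the bound.
\<close>

lemma (in bidirected_digraph) sum_arcs_picone:
  fixes f h :: "'a \<Rightarrow> real"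
  assumes A: "A \<subseteq> arcs G" "\<And>a. a \<in> A \<Longrightarrow> arev a \<in> A"
    and h: "\<And>x. x \<in> verts G \<Longrightarrow> h x > 0"
  shows "2 * (\<Sum>a\<in>A. (f (tail G a))\<^sup>2 / h (tail G a) * (h (tail G a) - h (head G a)))
      \<le> (\<Sum>a\<in>A. (f (tail G a) - f (head G a))\<^sup>2)"
proof -
  define \<phi> where "\<phi> x = (f x)\<^sup>2 / h x" for x
  have "(\<Sum>a\<in>A. \<phi> (tail G a) * (h (tail G a) - h (head G a)))
      = (\<Sum>a\<in>A. \<phi> (head G a) * (h (head G a) - h (tail G a)))"
    by (rule sum.reindex_bij_witness[of _ arev arev]) (use A in auto)
  then have "2 * (\<Sum>a\<in>A. \<phi> (tail G a) * (h (tail G a) - h (head G a)))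
      = (\<Sum>a\<in>A. (\<phi> (tail G a) - \<phi> (head G a)) * (h (tail G a) - h (head G a)))"
    by (simp add: left_diff_distrib sum_subtractf right_diff_distrib)
  also have "\<dots> \<le> (\<Sum>a\<in>A. (f (tail G a) - f (head G a))\<^sup>2)"
    unfolding \<phi>_def using A h by (intro sum_mono picone_inequality) auto
  finally show ?thesis unfolding \<phi>_def .
qed

text \<open>
  Think of \<open>u\<close> as the probability of never hitting \<open>v\<close>: it vanishes at \<open>v\<close>, is harmonic elsewhere,
  and its mean over the neighbours of \<open>v\<close> is the escape probability \<open>p\<close>. Then \<open>2 - u\<close> is positive and
  superharmonic, with defect concentrated at \<open>v\<close>, where it equals \<open>p\<close>. Testing it against any
  finitely supported \<open>f\<close> bounds \<open>p\<close> by the Dirichlet energy of \<open>f\<close>. The set \<open>A\<close> is any finite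
  symmetric set of arcs that carries the gradient of \<open>f\<close>.
\<close>

lemma (in bidirected_digraph) flux_le_energy:
  fixes f u :: "'a \<Rightarrow> real"
  assumes fin: "\<And>x. x \<in> verts G \<Longrightarrow> finite (out_arcs G x)"
    and ne: "\<And>x. x \<in> verts G \<Longrightarrow> out_arcs G x \<noteq> {}"
    and v: "v \<in> verts G"
    and u: "\<And>x. u x \<le> 1" "u v = 0" and p: "p \<ge> 0"
    and mean: "\<And>x. x \<in> verts G \<Longrightarrow>
      (\<Sum>a\<in>out_arcs G x. u (head G a)) = card (out_arcs G x) * (if x = v then p else u x)"
    and supp: "finite {x \<in> verts G. f x \<noteq> 0}"
    and A: "finite A" "A \<subseteq> arcs G" "\<And>a. a \<in> A \<Longrightarrow> arev a \<in> A"
      "\<And>a. a \<in> arcs G \<Longrightarrow> f (tail G a) \<noteq> 0 \<Longrightarrow> a \<in> A"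
  shows "(f v)\<^sup>2 * p \<le> (\<Sum>a\<in>A. (f (tail G a) - f (head G a))\<^sup>2)"
proof -
  \<comment> \<open>As \<open>u\<close> is at most \<open>1\<close>, the constant \<open>2\<close> keeps \<open>h\<close> positive everywhere and \<open>h v = 2\<close>.\<close>
  define h where "h x = 2 - u x" for x
  have h_pos: "h x > 0" for x using u(1)[of x] by (simp add: h_def)
  define e where "e a = (f (tail G a))\<^sup>2 / h (tail G a) * (h (tail G a) - h (head G a))" for a
  define d where "d = real (card (out_arcs G v))"
  have "card (out_arcs G v) \<noteq> 0" using fin[OF v] ne[OF v] by simp
  then have d: "d \<ge> 1" by (simp add: d_def)
  let ?S = "{x \<in> verts G. f x \<noteq> 0}"
  have at: "(\<Sum>a\<in>out_arcs G x. e a) = (if x = v then (f v)\<^sup>2 / 2 * (d * p) else 0)"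
    if x: "x \<in> verts G" for x
  proof -
    have "(\<Sum>a\<in>out_arcs G x. e a) = (f x)\<^sup>2 / h x * (\<Sum>a\<in>out_arcs G x. u (head G a) - u x)"
      unfolding sum_distrib_left by (rule sum.cong) (auto simp: h_def e_def)
    also have "(\<Sum>a\<in>out_arcs G x. u (head G a) - u x)
        = card (out_arcs G x) * ((if x = v then p else u x) - u x)"
      unfolding sum_subtractf mean[OF x] by (simp add: right_diff_distrib)
    finally have *: "(\<Sum>a\<in>out_arcs G x. e a)
        = (f x)\<^sup>2 / h x * (card (out_arcs G x) * ((if x = v then p else u x) - u x))" .
    show ?thesis
      unfolding * by (auto simp: u(2) h_def d_def)
  qed
  have sub: "(\<Union>x\<in>?S. out_arcs G x) \<subseteq> A" using A(4) by (auto simp: out_arcs_def)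
  have zero: "\<forall>a\<in>A - (\<Union>x\<in>?S. out_arcs G x). e a = 0"
  proof
    fix a assume "a \<in> A - (\<Union>x\<in>?S. out_arcs G x)"
    then have "f (tail G a) = 0" using A(2) by (auto simp: out_arcs_def)
    then show "e a = 0" by (simp add: e_def)
  qed
  have "(\<Sum>a\<in>A. e a) = (\<Sum>a\<in>(\<Union>x\<in>?S. out_arcs G x). e a)"
    by (rule sum.mono_neutral_right[OF A(1) sub zero])
  also have "\<dots> = (\<Sum>x\<in>?S. \<Sum>a\<in>out_arcs G x. e a)"
    by (rule sum.UNION_disjoint) (use supp fin in \<open>auto simp: out_arcs_def\<close>)
  also have "\<dots> = (\<Sum>x\<in>?S. if x = v then (f v)\<^sup>2 / 2 * (d * p) else 0)"
    by (rule sum.cong[OF refl], rule at) blast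
  also have "\<dots> = (f v)\<^sup>2 / 2 * (d * p)"
    using v supp by (simp add: sum.delta)
  finally have "2 * (\<Sum>a\<in>A. e a) = d * ((f v)\<^sup>2 * p)" by (simp add: ac_simps)
  moreover have "2 * (\<Sum>a\<in>A. e a) \<le> (\<Sum>a\<in>A. (f (tail G a) - f (head G a))\<^sup>2)"
    unfolding e_def by (rule sum_arcs_picone[OF A(2,3)]) (auto intro: h_pos)
  moreover have "1 * ((f v)\<^sup>2 * p) \<le> d * ((f v)\<^sup>2 * p)"
    using d p by (intro mult_right_mono) auto
  ultimately show ?thesis by linarith
qed

section \<open>The probability of no return\<close>

text \<open>
  The law of the first \<open>n + 1\<close> positions of the walk, with the most recent position first: the next
  step depends on the head of the list, and extending the path is consing.
\<close>

primrec path_pmf :: "('a, 'b) pre_digraph \<Rightarrow> 'a \<Rightarrow> nat \<Rightarrow> 'a list pmf" where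
  "path_pmf G v 0 = return_pmf [v]"
| "path_pmf G v (Suc n) =
     bind_pmf (path_pmf G v n) (\<lambda>l. map_pmf (\<lambda>y. y # l) (srw_step G (hd l)))"

lemma length_path_pmf: "l \<in> set_pmf (path_pmf G v n) \<Longrightarrow> length l = Suc n"
  by (induction n arbitrary: l) auto

lemma pmf_path_pmf_Cons:
  "pmf (path_pmf G v (Suc n)) (y # l) = pmf (path_pmf G v n) l * pmf (srw_step G (hd l)) y"
proof -
  have *: "pmf (map_pmf (\<lambda>y. y # l') p) (y # l) = indicator {l} l' * pmf p y" for l' and p :: "'a pmf"
  proof (cases "l' = l")
    case True
    have "inj (\<lambda>y. y # l)" by (auto simp: inj_def)
    from pmf_map_inj'[OF this, of p y] show ?thesis using True by simp
  qed (auto simp: pmf_eq_0_set_pmf)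
  have "ennreal (pmf (path_pmf G v (Suc n)) (y # l))
      = (\<integral>\<^sup>+l'. ennreal (pmf (srw_step G (hd l)) y) * indicator {l} l' \<partial>path_pmf G v n)"
    unfolding path_pmf.simps ennreal_pmf_bind
    by (intro nn_integral_cong) (auto simp: * indicator_def)
  also have "\<dots> = ennreal (pmf (srw_step G (hd l)) y * pmf (path_pmf G v n) l)"
    by (subst nn_integral_cmult) (simp_all add: emeasure_pmf_single ennreal_mult')
  finally show ?thesis by (simp add: mult.commute)
qed

lemma pmf_path_pmf:
  "pmf (path_pmf G v n) (rev (map x [0..<Suc n])) =
     indicator {v} (x 0) * (\<Prod>i<n. pmf (srw_step G (x i)) (x (Suc i)))"
proof (induction n)
  case 0
  then show ?case by (auto simp: indicator_def)
next
  case (Suc n)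
  have "rev (map x [0..<Suc (Suc n)]) = x (Suc n) # rev (map x [0..<Suc n])" by simp
  moreover have "hd (rev (map x [0..<Suc n])) = x n" by simp
  ultimately show ?case
    using Suc pmf_path_pmf_Cons[of G v n "x (Suc n)" "rev (map x [0..<Suc n])"] by simp
qed

lemma space_simple_random_walk [simp]: "space (simple_random_walk G v) = UNIV"
proof -
  interpret IT: Ionescu_Tulcea "srw_kernel G v" "\<lambda>_. count_space UNIV"
    by (rule Ionescu_Tulcea_srw)
  show ?thesis by (simp add: simple_random_walk_def space_PiM)
qed

lemma sets_simple_random_walk [simp, measurable_cong]:
  "sets (simple_random_walk G v) = sets (\<Pi>\<^sub>M i\<in>UNIV. count_space UNIV)"
proof -
  interpret IT: Ionescu_Tulcea "srw_kernel G v" "\<lambda>_. count_space UNIV"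
    by (rule Ionescu_Tulcea_srw)
  show ?thesis by (simp add: simple_random_walk_def)
qed

lemma measurable_coordinate [measurable]:
  "(\<lambda>\<omega>. \<omega> i) \<in> measurable (simple_random_walk G v) (count_space UNIV)"
  by (simp add: measurable_cong_sets[OF sets_simple_random_walk refl])

lemma vimage_path:
  "(\<lambda>\<omega>. rev (map \<omega> [0..<Suc n])) -` {l} =
     (if length l = Suc n then {\<omega>. \<forall>i\<le>n. \<omega> i = rev l ! i} else {})"
proof -
  have "rev (map \<omega> [0..<Suc n]) = l \<longleftrightarrow> map \<omega> [0..<Suc n] = rev l" for \<omega>
    by (metis rev_rev_ident)
  also have "map \<omega> [0..<Suc n] = rev l \<longleftrightarrow> length l = Suc n \<and> (\<forall>i\<le>n. \<omega> i = rev l ! i)" for \<omega>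
    by (auto simp del: upt_Suc simp: list_eq_iff_nth_eq less_Suc_eq_le)
  finally show ?thesis by auto
qed

lemma measurable_path:
  fixes G :: "('a :: countable, 'b) pre_digraph"
  shows "(\<lambda>\<omega>. rev (map \<omega> [0..<Suc n])) \<in> measurable (simple_random_walk G v) (count_space UNIV)"
proof -
  have "{\<omega> \<in> space (simple_random_walk G v). \<forall>i\<le>n. \<omega> i = x i} \<in> sets (simple_random_walk G v)" for x
    by measurable
  then have "(\<lambda>\<omega>. rev (map \<omega> [0..<Suc n])) -` {l} \<in> sets (simple_random_walk G v)" for l
    unfolding vimage_path by simp
  then show ?thesis
    by (subst measurable_count_space_eq_countable) auto
qed

text \<open>
  The vertices are countably many, hence so are the finite paths, and it is enough to compare the
  masses of single paths; those of the walk are the masses of cylinders.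
\<close>

lemma distr_simple_random_walk:
  fixes G :: "('a :: countable, 'b) pre_digraph"
  shows "distr (simple_random_walk G v) (count_space UNIV) (\<lambda>\<omega>. rev (map \<omega> [0..<Suc n]))
     = measure_pmf (path_pmf G v n)"
proof (rule measure_eqI_countable[where A = UNIV])
  show "emeasure (distr (simple_random_walk G v) (count_space UNIV) (\<lambda>\<omega>. rev (map \<omega> [0..<Suc n]))) {l}
      = emeasure (measure_pmf (path_pmf G v n)) {l}" for l
  proof -
    have "emeasure (distr (simple_random_walk G v) (count_space UNIV) (\<lambda>\<omega>. rev (map \<omega> [0..<Suc n]))) {l}
       = emeasure (simple_random_walk G v) (if length l = Suc n then {\<omega>. \<forall>i\<le>n. \<omega> i = rev l ! i} else {})"
      by (subst emeasure_distr[OF measurable_path]) (simp_all only: vimage_path space_simple_random_walk Int_UNIV_right sets_count_space Pow_UNIV UNIV_I)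
    also have "\<dots> = emeasure (measure_pmf (path_pmf G v n)) {l}"
    proof (cases "length l = Suc n")
      case True
      have "rev (map (\<lambda>i. rev l ! i) [0..<Suc n]) = l"
        using True by (metis length_rev map_nth rev_rev_ident)
      then show ?thesis
        using True pmf_path_pmf[of G v n "\<lambda>i. rev l ! i"]
        by (simp add: simple_random_walk_cylinder emeasure_pmf_single del: upt_Suc)
    next
      case False
      then have "l \<notin> set_pmf (path_pmf G v n)" by (auto dest: length_path_pmf)
      then show ?thesis using False by (simp add: emeasure_pmf_single pmf_eq_0_set_pmf)
    qed
    finally show ?thesis .
  qed
qed auto

text \<open>
  The probability that the walk started at \<open>x\<close> does not visit \<open>v\<close> at any of the times \<open>1, ..., n\<close>;
  the starting point itself is allowed to be \<open>v\<close>. The recursion conditions on the first step.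
\<close>

primrec avoid_prob :: "('a, 'b) pre_digraph \<Rightarrow> 'a \<Rightarrow> nat \<Rightarrow> 'a \<Rightarrow> ennreal" where
  "avoid_prob G v 0 x = 1"
| "avoid_prob G v (Suc n) x =
     (\<integral>\<^sup>+y. indicator (- {v}) y * avoid_prob G v n y \<partial>measure_pmf (srw_step G x))"

text \<open>
  The Markov property: avoiding \<open>v\<close> for \<open>n\<close> steps and then, from the current position, for \<open>k\<close> more is
  avoiding it for \<open>n + k\<close> steps. A path list ends with the starting point \<open>v\<close>, which does not count
  as a visit; this is why \<open>butlast\<close> appears.
\<close>

lemma nn_integral_path_pmf_avoid:
  "(\<integral>\<^sup>+l. indicator {l. v \<notin> set (butlast l)} l * avoid_prob G v k (hd l) \<partial>path_pmf G v n)
     = avoid_prob G v (n + k) v"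
proof (induction n arbitrary: k)
  case (Suc n)
  have "(\<integral>\<^sup>+l. indicator {l. v \<notin> set (butlast l)} l * avoid_prob G v k (hd l) \<partial>path_pmf G v (Suc n))
     = (\<integral>\<^sup>+l. (\<integral>\<^sup>+y. indicator {l. v \<notin> set (butlast l)} (y # l) * avoid_prob G v k y
          \<partial>srw_step G (hd l)) \<partial>path_pmf G v n)"
    by simp
  also have "\<dots> = (\<integral>\<^sup>+l. indicator {l. v \<notin> set (butlast l)} l * avoid_prob G v (Suc k) (hd l)
      \<partial>path_pmf G v n)"
  proof (intro nn_integral_cong_AE, simp only: AE_measure_pmf_iff, intro ballI)
    fix l assume "l \<in> set_pmf (path_pmf G v n)"
    then have "l \<noteq> []" using length_path_pmf by fastforce
    then have "(\<integral>\<^sup>+y. indicator {l. v \<notin> set (butlast l)} (y # l) * avoid_prob G v k y \<partial>srw_step G (hd l))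
       = (\<integral>\<^sup>+y. indicator {l. v \<notin> set (butlast l)} l * (indicator (- {v}) y * avoid_prob G v k y)
          \<partial>srw_step G (hd l))"
      by (intro nn_integral_cong) (auto simp: indicator_def)
    then show "(\<integral>\<^sup>+y. indicator {l. v \<notin> set (butlast l)} (y # l) * avoid_prob G v k y \<partial>srw_step G (hd l))
       = indicator {l. v \<notin> set (butlast l)} l * avoid_prob G v (Suc k) (hd l)"
      by (simp add: nn_integral_cmult)
  qed
  also have "\<dots> = avoid_prob G v (n + Suc k) v" by (rule Suc)
  finally show ?case by simp
qed simp

lemma emeasure_no_return:
  fixes G :: "('a :: countable, 'b) pre_digraph"
  shows "emeasure (simple_random_walk G v) {\<omega>. \<forall>i\<in>{1..n}. \<omega> i \<noteq> v} = avoid_prob G v n v"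
proof -
  let ?W = "simple_random_walk G v" and ?r = "\<lambda>\<omega>. rev (map \<omega> [0..<Suc n])"
  let ?B = "{l. v \<notin> set (butlast l)}"
  have "v \<notin> set (butlast (?r \<omega>)) \<longleftrightarrow> (\<forall>i\<in>{1..n}. \<omega> i \<noteq> v)" for \<omega> :: "nat \<Rightarrow> 'a"
  proof -
    have "[0..<Suc n] = 0 # [1..<Suc n]" by (simp add: upt_conv_Cons del: upt_Suc)
    then have "butlast (?r \<omega>) = rev (map \<omega> [1..<Suc n])" by (simp del: upt_Suc)
    then show ?thesis by (auto simp del: upt_Suc)
  qed
  then have "?r -` ?B \<inter> space ?W = {\<omega>. \<forall>i\<in>{1..n}. \<omega> i \<noteq> v}" by auto
  then have "emeasure ?W {\<omega>. \<forall>i\<in>{1..n}. \<omega> i \<noteq> v} = emeasure (distr ?W (count_space UNIV) ?r) ?B"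
    by (subst emeasure_distr[OF measurable_path]) auto
  also have "\<dots> = (\<integral>\<^sup>+l. indicator ?B l * avoid_prob G v 0 (hd l) \<partial>path_pmf G v n)"
    unfolding distr_simple_random_walk by simp
  finally show ?thesis by (simp only: nn_integral_path_pmf_avoid add_0_right)
qed

lemma avoid_prob_le_1: "avoid_prob G v n x \<le> 1"
proof (induction n arbitrary: x)
  case (Suc n)
  have "avoid_prob G v (Suc n) x \<le> (\<integral>\<^sup>+y. 1 \<partial>measure_pmf (srw_step G x))"
    unfolding avoid_prob.simps using Suc by (intro nn_integral_mono) (auto simp: indicator_def)
  then show ?case by simp
qed simp

lemma avoid_prob_Suc_le: "avoid_prob G v (Suc n) x \<le> avoid_prob G v n x"
proof (induction n arbitrary: x)
  case 0
  then show ?case using avoid_prob_le_1[of G v 1 x] by simp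
next
  case (Suc n)
  show ?case
    unfolding avoid_prob.simps(2)[of G v "Suc n"] avoid_prob.simps(2)[of G v n]
    using Suc by (intro nn_integral_mono mult_left_mono) auto
qed

text \<open>
  The recursion for \<open>avoid_prob\<close> as a finite sum over arcs, in the reals, so that limits can be
  taken termwise.
\<close>

lemma sum_out_arcs_avoid_prob:
  assumes fin: "finite (out_arcs G x)" and ne: "out_arcs G x \<noteq> {}"
  shows "real (card (out_arcs G x)) * enn2real (avoid_prob G v (Suc n) x)
     = (\<Sum>a\<in>out_arcs G x. indicator (- {v}) (head G a) * enn2real (avoid_prob G v n (head G a)))"
proof -
  let ?u = "\<lambda>y. indicator (- {v}) y * enn2real (avoid_prob G v n y) :: real"
  have "ennreal (?u y) = indicator (- {v}) y * avoid_prob G v n y" for y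
    using avoid_prob_le_1[of G v n y]
    by (auto simp: indicator_def ennreal_enn2real_if top_unique)
  then have "avoid_prob G v (Suc n) x = (\<integral>\<^sup>+y. ennreal (?u y) \<partial>measure_pmf (srw_step G x))"
    by simp
  also have "\<dots> = (\<Sum>a\<in>out_arcs G x. ennreal (?u (head G a))) / card (out_arcs G x)"
    unfolding srw_step_def by (simp add: nn_integral_pmf_of_set[OF ne fin])
  also have "\<dots> = ennreal ((\<Sum>a\<in>out_arcs G x. ?u (head G a)) / card (out_arcs G x))"
    using ne fin
    by (simp add: sum_ennreal divide_ennreal[symmetric] sum_nonneg card_gt_0_iff ennreal_of_nat_eq_real_of_nat)
  finally have "enn2real (avoid_prob G v (Suc n) x) = (\<Sum>a\<in>out_arcs G x. ?u (head G a)) / card (out_arcs G x)"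
    by (simp add: sum_nonneg)
  then show ?thesis using ne fin by (simp add: card_gt_0_iff)
qed

text \<open>
  The probability of never visiting \<open>v\<close> at a positive time. The sequence decreases, so the limit
  exists.
\<close>

definition escape_prob :: "('a, 'b) pre_digraph \<Rightarrow> 'a \<Rightarrow> 'a \<Rightarrow> real" where
  "escape_prob G v x = lim (\<lambda>n. enn2real (avoid_prob G v n x))"

lemma enn2real_avoid_prob_le_1: "enn2real (avoid_prob G v n x) \<le> 1"
  using avoid_prob_le_1[of G v n x] enn2real_mono[of "avoid_prob G v n x" 1] by simp

lemma avoid_prob_tendsto:
  "(\<lambda>n. enn2real (avoid_prob G v n x)) \<longlonglongrightarrow> escape_prob G v x"
proof -
  have "decseq (\<lambda>n. enn2real (avoid_prob G v n x))"
  proof (rule decseq_SucI)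
    fix n
    have "avoid_prob G v n x < \<top>"
      using avoid_prob_le_1[of G v n x] by (auto simp: less_top[symmetric] top_unique)
    then show "enn2real (avoid_prob G v (Suc n) x) \<le> enn2real (avoid_prob G v n x)"
      by (intro enn2real_mono avoid_prob_Suc_le)
  qed
  then have "convergent (\<lambda>n. enn2real (avoid_prob G v n x))"
    by (rule decseq_convergent[of _ 0]) (auto simp: convergent_def)
  then show ?thesis unfolding escape_prob_def by (simp add: convergent_LIMSEQ_iff)
qed

lemma escape_prob_nonneg: "0 \<le> escape_prob G v x"
  by (rule LIMSEQ_le_const[OF avoid_prob_tendsto]) auto

lemma escape_prob_le_1: "escape_prob G v x \<le> 1"
  by (rule LIMSEQ_le_const2[OF avoid_prob_tendsto]) (auto simp: enn2real_avoid_prob_le_1)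

lemma sum_out_arcs_escape_prob:
  assumes "finite (out_arcs G x)" "out_arcs G x \<noteq> {}"
  shows "(\<Sum>a\<in>out_arcs G x. indicator (- {v}) (head G a) * escape_prob G v (head G a))
    = real (card (out_arcs G x)) * escape_prob G v x"
proof (rule LIMSEQ_unique)
  show "(\<lambda>n. \<Sum>a\<in>out_arcs G x. indicator (- {v}) (head G a) * enn2real (avoid_prob G v n (head G a)))
    \<longlonglongrightarrow> (\<Sum>a\<in>out_arcs G x. indicator (- {v}) (head G a) * escape_prob G v (head G a))"
    by (intro tendsto_intros avoid_prob_tendsto)
  have "(\<lambda>n. \<Sum>a\<in>out_arcs G x. indicator (- {v}) (head G a) * enn2real (avoid_prob G v n (head G a)))
    = (\<lambda>n. real (card (out_arcs G x)) * enn2real (avoid_prob G v (Suc n) x))"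
    by (rule ext, rule sum_out_arcs_avoid_prob[OF assms, symmetric])
  also have "\<dots> \<longlonglongrightarrow> real (card (out_arcs G x)) * escape_prob G v x"
    by (rule tendsto_mult[OF tendsto_const LIMSEQ_Suc[OF avoid_prob_tendsto]])
  finally show "(\<lambda>n. \<Sum>a\<in>out_arcs G x. indicator (- {v}) (head G a) * enn2real (avoid_prob G v n (head G a)))
    \<longlonglongrightarrow> real (card (out_arcs G x)) * escape_prob G v x" .
qed

lemma AE_return_if_escape_prob_0:
  fixes G :: "('a :: countable, 'b) pre_digraph"
  assumes "escape_prob G v v = 0"
  shows "AE \<omega> in simple_random_walk G v. \<exists>n\<ge>1. \<omega> n = v"
proof (rule AE_I)
  let ?W = "simple_random_walk G v" and ?N = "{\<omega>. \<forall>n\<ge>1. \<omega> n \<noteq> v}"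
  show "{\<omega> \<in> space ?W. \<not> (\<exists>n\<ge>1. \<omega> n = v)} \<subseteq> ?N" by auto
  have "{\<omega> \<in> space ?W. \<forall>n\<ge>1. \<omega> n \<noteq> v} \<in> sets ?W" by measurable
  then show N: "?N \<in> sets ?W" by simp
  have bound: "emeasure ?W ?N \<le> avoid_prob G v n v" for n
  proof -
    have "{\<omega> \<in> space ?W. \<forall>i\<in>{1..n}. \<omega> i \<noteq> v} \<in> sets ?W" by measurable
    then have "emeasure ?W ?N \<le> emeasure ?W {\<omega>. \<forall>i\<in>{1..n}. \<omega> i \<noteq> v}"
      by (intro emeasure_mono) auto
    then show ?thesis by (simp only: emeasure_no_return)
  qed
  have fin: "emeasure ?W ?N < \<top>"
    using bound[of 0] by (rule order.strict_trans1) simp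
  have "enn2real (emeasure ?W ?N) \<le> escape_prob G v v"
  proof (rule LIMSEQ_le_const[OF avoid_prob_tendsto], intro exI allI impI)
    fix n
    have "avoid_prob G v n v < \<top>"
      using avoid_prob_le_1[of G v n v] by (auto simp: less_top[symmetric] top_unique)
    then show "enn2real (emeasure ?W ?N) \<le> enn2real (avoid_prob G v n v)"
      by (intro enn2real_mono bound)
  qed
  then have "enn2real (emeasure ?W ?N) = 0" using assms by (simp add: antisym)
  then show "emeasure ?W ?N = 0" using fin by (auto simp: enn2real_eq_0_iff)
qed

text \<open>
  The function that is \<open>0\<close> at \<open>v\<close> and the escape probability elsewhere satisfies the hypotheses of
  \<open>flux_le_energy\<close>: by the first-step relation its mean over the neighbours of \<open>x\<close> is the escape
  probability from \<open>x\<close>, also for \<open>x = v\<close>.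
\<close>

lemma (in bidirected_digraph) escape_prob_le_energy:
  fixes f :: "'a \<Rightarrow> real"
  assumes fin: "\<And>x. x \<in> verts G \<Longrightarrow> finite (out_arcs G x)"
    and ne: "\<And>x. x \<in> verts G \<Longrightarrow> out_arcs G x \<noteq> {}"
    and v: "v \<in> verts G"
    and supp: "finite {x \<in> verts G. f x \<noteq> 0}"
    and A: "finite A" "A \<subseteq> arcs G" "\<And>a. a \<in> A \<Longrightarrow> arev a \<in> A"
      "\<And>a. a \<in> arcs G \<Longrightarrow> f (tail G a) \<noteq> 0 \<Longrightarrow> a \<in> A"
  shows "(f v)\<^sup>2 * escape_prob G v v \<le> (\<Sum>a\<in>A. (f (tail G a) - f (head G a))\<^sup>2)"
proof (rule flux_le_energy[where u = "\<lambda>x. indicator (- {v}) x * escape_prob G v x", OF fin ne v _ _ escape_prob_nonneg _ supp A])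
  show "indicator (- {v}) x * escape_prob G v x \<le> 1" for x
    using escape_prob_le_1[of G v x] by (simp add: indicator_def)
  show "indicator (- {v}) v * escape_prob G v v = 0" by simp
next
  fix x assume x: "x \<in> verts G"
  have *: "(if x = v then escape_prob G v v else indicator (- {v}) x * escape_prob G v x) = escape_prob G v x"
    by simp
  show "(\<Sum>a\<in>out_arcs G x. indicator (- {v}) (head G a) * escape_prob G v (head G a))
    = card (out_arcs G x) * (if x = v then escape_prob G v v else indicator (- {v}) x * escape_prob G v x)"
    unfolding * using sum_out_arcs_escape_prob[OF fin[OF x] ne[OF x], of v] .
qed

section \<open>A Nash-Williams criterion for layered graphs\<close>

text \<open>
  The arcs from layer \<open>k\<close> to layer \<open>k + 1\<close> form a cutset. Shorting every layer to a point gives a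
  path whose \<open>k\<close>-th edge has as resistance \<open>r k\<close> the inverse size of this cutset. The test function is
  the resistance \<open>f x\<close> between the layer of \<open>x\<close> and layer \<open>N\<close>. Its energy is twice the resistance \<open>R N\<close>
  of the first \<open>N\<close> edges of the path, because each edge is seen in both orientations and a cutset of
  size \<open>1 / r\<close> contributes \<open>r\<close>. On the other hand \<open>(f v)\<^sup>2\<close> grows like the square of \<open>R N\<close>. Hence the
  escape probability is at most of order \<open>1 / R N\<close>, which tends to \<open>0\<close>. An empty cutset has \<open>r k = 0\<close>
  by the convention for division by zero, and the computation is unaffected.
\<close>

theorem recurrent_if_sum_inverse_layers_diverges:
  fixes G :: "('a :: countable, 'b) pre_digraph" and l :: "'a \<Rightarrow> nat"
  assumes "bidirected_digraph G arev"
    and fin: "\<And>x. x \<in> verts G \<Longrightarrow> finite (out_arcs G x)"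
    and ne: "\<And>x. x \<in> verts G \<Longrightarrow> out_arcs G x \<noteq> {}"
    and layer: "\<And>k. finite {x \<in> verts G. l x = k}"
    and step: "\<And>a. a \<in> arcs G \<Longrightarrow> l (head G a) \<le> Suc (l (tail G a))"
    and div: "\<not> summable (\<lambda>k. 1 / real (card {a \<in> arcs G. l (tail G a) = k \<and> l (head G a) = Suc k}))"
  shows "recurrent G"
proof -
  interpret bidirected_digraph G arev by fact
  define U where "U k = {a \<in> arcs G. l (tail G a) = k \<and> l (head G a) = Suc k}" for k
  define r where "r k = 1 / real (card (U k))" for k
  define R where "R N = (\<Sum>k<N. r k)" for N
  have r_nonneg: "r k \<ge> 0" for k by (simp add: r_def)
  have unbounded: "\<exists>N. R N > B" for B
  proof (rule ccontr)
    assume "\<not> ?thesis"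
    then have "summable r"
      by (intro summableI_nonneg_bounded[where x = B]) (auto simp: r_nonneg R_def not_less)
    with div show False by (simp add: r_def[abs_def] U_def)
  qed
  have fin_U: "finite (U k)" for k
  proof (rule finite_subset)
    show "U k \<subseteq> (\<Union>x\<in>{x \<in> verts G. l x = k}. out_arcs G x)" by (auto simp: U_def)
    show "finite (\<Union>x\<in>{x \<in> verts G. l x = k}. out_arcs G x)" using layer fin by auto
  qed
  have step': "l (tail G a) \<le> Suc (l (head G a))" if "a \<in> arcs G" for a
    using step[of "arev a"] that by simp
  have energy: "(R N - R (l v))\<^sup>2 * escape_prob G v v \<le> 2 * R N"
    if v: "v \<in> verts G" and N: "l v \<le> N" for v N
  proof -
    define f where "f x = (\<Sum>k\<in>{l x..<N}. r k)" for x
    define g where "g a = (f (tail G a) - f (head G a))\<^sup>2" for a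
    define A where "A = {a \<in> arcs G. l (tail G a) < N \<or> l (head G a) < N}"
    define Up where "Up = (\<Union>k<N. U k)"
    have layers: "finite {x \<in> verts G. l x < N}"
    proof (rule finite_subset)
      show "{x \<in> verts G. l x < N} \<subseteq> (\<Union>k<N. {x \<in> verts G. l x = k})" by auto
    qed (use layer in auto)
    have fin_A: "finite A"
    proof (rule finite_subset)
      let ?B = "\<Union>x\<in>{x \<in> verts G. l x < N}. out_arcs G x"
      show "A \<subseteq> ?B \<union> arev ` ?B"
      proof
        fix a assume "a \<in> A"
        then have a: "a \<in> arcs G" "l (tail G a) < N \<or> l (head G a) < N" by (auto simp: A_def)
        show "a \<in> ?B \<union> arev ` ?B"
        proof (cases "l (tail G a) < N")
          case False
          then have "arev a \<in> ?B" using a by auto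
          then have "arev (arev a) \<in> arev ` ?B" by blast
          then show ?thesis by simp
        qed (use a in auto)
      qed
      show "finite (?B \<union> arev ` ?B)" using layers fin by auto
    qed
    have fin_Up: "finite Up" using fin_U by (simp add: Up_def)
    have Up_iff: "a \<in> Up \<longleftrightarrow> a \<in> arcs G \<and> l (tail G a) < N \<and> l (head G a) = Suc (l (tail G a))" for a
      by (auto simp: Up_def U_def)
    have "(f v)\<^sup>2 * escape_prob G v v \<le> sum g A"
      unfolding g_def
    proof (rule escape_prob_le_energy[OF fin ne v _ fin_A])
      have "{x \<in> verts G. f x \<noteq> 0} \<subseteq> {x \<in> verts G. l x < N}"
        by (auto simp: f_def not_le[symmetric])
      then show "finite {x \<in> verts G. f x \<noteq> 0}" using layers by (rule finite_subset)
      show "a \<in> A" if "a \<in> arcs G" "f (tail G a) \<noteq> 0" for a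
        using that by (auto simp: A_def f_def not_le[symmetric])
    qed (auto simp: A_def)
    also have "sum g A = sum g (Up \<union> arev ` Up)"
    proof (rule sum.mono_neutral_right[OF fin_A])
      show "Up \<union> arev ` Up \<subseteq> A" by (auto simp: Up_iff A_def)
      show "\<forall>a\<in>A - (Up \<union> arev ` Up). g a = 0"
      proof
        fix a assume a: "a \<in> A - (Up \<union> arev ` Up)"
        then have arc: "a \<in> arcs G" by (simp add: A_def)
        have "a \<notin> arev ` Up" using a by blast
        then have "arev a \<notin> Up" using arev_arev[of a] by (metis image_eqI)
        then have "l (tail G a) \<noteq> Suc (l (head G a)) \<or> N \<le> l (head G a)"
          using arc by (auto simp: Up_iff not_less)
        moreover have "l (head G a) \<noteq> Suc (l (tail G a)) \<or> N \<le> l (tail G a)"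
          using a arc by (auto simp: Up_iff)
        ultimately have "l (tail G a) = l (head G a)"
          using step[OF arc] step'[OF arc] a by (auto simp: A_def)
        then show "g a = 0" by (simp add: g_def f_def)
      qed
    qed
    also have "\<dots> = sum g Up + sum g (arev ` Up)"
      by (rule sum.union_disjoint) (use fin_Up in \<open>auto simp: Up_iff\<close>)
    also have "sum g (arev ` Up) = sum g Up"
    proof -
      have "inj_on arev Up" by (metis arev_arev inj_onI)
      then have "sum g (arev ` Up) = (\<Sum>a\<in>Up. g (arev a))" by (simp add: sum.reindex)
      also have "\<dots> = sum g Up"
        by (rule sum.cong) (auto simp: g_def Up_iff power2_commute)
      finally show ?thesis .
    qed
    also have "sum g Up = (\<Sum>k<N. sum g (U k))"
      unfolding Up_def by (rule sum.UNION_disjoint) (auto simp: fin_U, auto simp: U_def)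
    also have "\<dots> = R N"
      unfolding R_def
    proof (rule sum.cong[OF refl])
      fix k assume k: "k \<in> {..<N}"
      have "g a = (r k)\<^sup>2" if "a \<in> U k" for a
      proof -
        have "f (tail G a) = r k + f (head G a)"
          using that k by (simp add: U_def f_def sum.atLeast_Suc_lessThan)
        then show ?thesis by (simp add: g_def)
      qed
      then have "sum g (U k) = card (U k) * (r k)\<^sup>2" by simp
      also have "\<dots> = r k" by (simp add: r_def power2_eq_square)
      finally show "sum g (U k) = r k" .
    qed
    finally have "(f v)\<^sup>2 * escape_prob G v v \<le> 2 * R N" by simp
    moreover have "f v = R N - R (l v)"
      using N sum.atLeastLessThan_concat[of 0 "l v" N r]
      by (simp add: f_def R_def lessThan_atLeast0)
    ultimately show ?thesis by simp
  qed
  have "escape_prob G v v = 0" if v: "v \<in> verts G" for v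
  proof (rule ccontr)
    assume "escape_prob G v v \<noteq> 0"
    then have p: "escape_prob G v v > 0" using escape_prob_nonneg[of G v v] by simp
    have mono: "R m \<le> R n" if "m \<le> n" for m n
      unfolding R_def by (rule sum_mono2) (use that r_nonneg in auto)
    \<comment> \<open>Beyond this bound \<open>R N - R (l v) \<ge> R N / 2\<close>, and \<open>(R N / 2)\<^sup>2\<close> times the escape probability exceeds \<open>2 * R N\<close>.\<close>
    define B where "B = 2 * R (l v) + 8 / escape_prob G v v"
    have R0: "R (l v) \<ge> 0" by (simp add: R_def sum_nonneg r_nonneg)
    obtain N0 where "R N0 > B" using unbounded by blast
    then obtain N where N: "R N > B" "l v \<le> N"
      using mono[of N0 "max N0 (l v)"] by (metis max.cobounded1 max.cobounded2 order_less_le_trans)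
    have *: "8 / escape_prob G v v > 0" using p by simp
    have RN: "R N > 0" "R N / 2 \<le> R N - R (l v)" using N(1)[unfolded B_def] R0 * by linarith+
    have "(R N / 2)\<^sup>2 * escape_prob G v v \<le> (R N - R (l v))\<^sup>2 * escape_prob G v v"
      using RN p by (intro mult_right_mono power_mono) auto
    also have "\<dots> \<le> 2 * R N" by (rule energy[OF v N(2)])
    finally have "R N * (R N * escape_prob G v v) \<le> R N * 8"
      by (simp add: power2_eq_square field_simps)
    then have "R N * escape_prob G v v \<le> 8" using RN(1) by simp
    then have "R N \<le> 8 / escape_prob G v v" using p by (simp add: field_simps)
    then show False using N(1) R0 by (simp add: B_def)
  qed
  then show ?thesis
    unfolding recurrent_def by (blast intro: AE_return_if_escape_prob_0)
qed

section \<open>Divergence of a random series\<close>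

text \<open>
  If the series were bounded by a constant \<open>K\<close> on an event \<open>A\<close> of probability \<open>a > 0\<close>, then by the
  Cauchy-Schwarz inequality \<open>E[1_A / X n] \<ge> a\<^sup>2 / E[1_A X n] \<ge> a\<^sup>2 / b n\<close>, and summation over \<open>n\<close> would
  contradict the divergence of the sum of \<open>1 / b n\<close>. The Cauchy-Schwarz inequality is used in the
  linearised form \<open>1 / x \<ge> 2 t - t\<^sup>2 x\<close> with the optimal \<open>t = a / b n\<close>, in which only
  the integrable \<open>X n\<close> occurs.
\<close>

lemma (in prob_space) AE_not_summable_inverse:
  fixes X :: "nat \<Rightarrow> 'a \<Rightarrow> real" and b :: "nat \<Rightarrow> real"
  assumes int [measurable]: "\<And>n. integrable M (X n)"
    and pos: "AE \<omega> in M. \<forall>n. X n \<omega> > 0"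
    and le_b: "\<And>n. expectation (X n) \<le> b n" and b: "\<And>n. b n > 0"
    and div: "\<not> summable (\<lambda>n. 1 / b n)"
  shows "AE \<omega> in M. \<not> summable (\<lambda>n. 1 / X n \<omega>)"
proof -
  have [measurable]: "X n \<in> borel_measurable M" for n
    using int by (rule borel_measurable_integrable)
  define A where "A K = {\<omega> \<in> space M. (\<forall>n. X n \<omega> > 0) \<and> (\<forall>N. (\<Sum>n<N. 1 / X n \<omega>) \<le> real K)}" for K :: nat
  have A [measurable]: "A K \<in> events" for K unfolding A_def by measurable
  have null: "prob (A K) = 0" for K
  proof (rule ccontr)
    define a where "a = prob (A K)"
    assume "prob (A K) \<noteq> 0"
    then have a: "a > 0" by (simp add: a_def zero_less_measure_iff)
    have "(\<Sum>n<N. 1 / b n) \<le> K / a" for N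
    proof -
      define t where "t n = a / b n" for n
      have AX: "integrable M (\<lambda>\<omega>. indicator (A K) \<omega> * X n \<omega>)" for n
        using integrable_mult_indicator[OF A int] by simp
      have IA: "integrable M (indicat_real (A K))" by (simp add: emeasure_eq_measure)
      have EX: "expectation (\<lambda>\<omega>. indicator (A K) \<omega> * X n \<omega>) \<le> b n" for n
      proof -
        have "expectation (\<lambda>\<omega>. indicator (A K) \<omega> * X n \<omega>) \<le> expectation (X n)"
          by (rule integral_mono_AE[OF AX int]) (use pos in eventually_elim, force simp: indicator_def less_imp_le)
        then show ?thesis using le_b[of n] by simp
      qed
      have "(\<Sum>n<N. a\<^sup>2 / b n) \<le> (\<Sum>n<N. 2 * t n * a - (t n)\<^sup>2 * expectation (\<lambda>\<omega>. indicator (A K) \<omega> * X n \<omega>))"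
      proof (rule sum_mono)
        fix n
        have "(t n)\<^sup>2 * expectation (\<lambda>\<omega>. indicator (A K) \<omega> * X n \<omega>) \<le> (t n)\<^sup>2 * b n"
          by (intro mult_left_mono EX) simp
        moreover have "2 * t n * a - (t n)\<^sup>2 * b n = a\<^sup>2 / b n"
          using b[of n] by (simp add: t_def power2_eq_square field_simps)
        ultimately show "a\<^sup>2 / b n \<le> 2 * t n * a - (t n)\<^sup>2 * expectation (\<lambda>\<omega>. indicator (A K) \<omega> * X n \<omega>)"
          by simp
      qed
      also have "\<dots> = expectation (\<lambda>\<omega>. \<Sum>n<N. 2 * t n * indicator (A K) \<omega> - (t n)\<^sup>2 * (indicator (A K) \<omega> * X n \<omega>))"
        using AX IA by (simp add: a_def)
      also have "\<dots> \<le> expectation (\<lambda>\<omega>. real K * indicator (A K) \<omega>)"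
      proof (rule integral_mono)
        fix \<omega> assume "\<omega> \<in> space M"
        show "(\<Sum>n<N. 2 * t n * indicator (A K) \<omega> - (t n)\<^sup>2 * (indicator (A K) \<omega> * X n \<omega>)) \<le> real K * indicator (A K) \<omega>"
        proof (cases "\<omega> \<in> A K")
          case True
          have "(\<Sum>n<N. 2 * t n - (t n)\<^sup>2 * X n \<omega>) \<le> (\<Sum>n<N. 1 / X n \<omega>)"
          proof (rule sum_mono)
            fix n
            have X: "X n \<omega> > 0" using True by (simp add: A_def)
            have "1 / X n \<omega> - (2 * t n - (t n)\<^sup>2 * X n \<omega>) = (1 - t n * X n \<omega>)\<^sup>2 / X n \<omega>"
              using X by (simp add: power2_eq_square field_simps)
            also have "\<dots> \<ge> 0" using X by simp
            finally show "2 * t n - (t n)\<^sup>2 * X n \<omega> \<le> 1 / X n \<omega>" by simp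
          qed
          also have "\<dots> \<le> K" using True by (simp add: A_def)
          finally show ?thesis using True by simp
        qed simp
      qed (use AX IA in auto)
      also have "\<dots> = K * a" by (simp add: a_def)
      finally have "a * (a * (\<Sum>n<N. 1 / b n)) \<le> a * K"
        by (simp add: sum_distrib_left power2_eq_square mult_ac)
      then show ?thesis using a by (simp add: field_simps)
    qed
    then have "summable (\<lambda>n. 1 / b n)"
      using b by (intro summableI_nonneg_bounded[where x = "K / a"]) (auto intro: less_imp_le)
    with div show False ..
  qed
  have "AE \<omega> in M. \<forall>K. \<omega> \<notin> A K"
    unfolding AE_all_countable
    by (intro allI AE_not_in) (simp add: null_sets_def A emeasure_eq_measure null)
  with pos AE_space show ?thesis
  proof eventually_elim
    case (elim \<omega>)
    show ?case
    proof
      assume S: "summable (\<lambda>n. 1 / X n \<omega>)"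
      obtain K :: nat where "(\<Sum>n. 1 / X n \<omega>) \<le> K" using real_arch_simple by blast
      then have "(\<Sum>n<N. 1 / X n \<omega>) \<le> K" for N
        using sum_le_suminf[OF S, of "{..<N}"] elim by (force intro: less_imp_le)
      then have "\<omega> \<in> A K" using elim by (simp add: A_def)
      with elim show False by blast
    qed
  qed
qed

section \<open>Moments of the generation sizes\<close>

text \<open>
  A product measure is its own image when one coordinate is overwritten by an independent sample;
  Fubini's theorem makes this an identity of integrals, from which independence can be read off.
\<close>

lemma nn_integral_PiM_resample:
  fixes M :: "'i \<Rightarrow> 'a measure" and f :: "('i \<Rightarrow> 'a) \<Rightarrow> ennreal"
  assumes M: "\<And>i. prob_space (M i)" and [measurable]: "f \<in> borel_measurable (PiM UNIV M)"
  shows "(\<integral>\<^sup>+\<xi>. f \<xi> \<partial>PiM UNIV M) = (\<integral>\<^sup>+\<xi>. (\<integral>\<^sup>+x. f (\<xi>(u := x)) \<partial>M u) \<partial>PiM UNIV M)"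
proof -
  interpret P: prob_space "PiM UNIV M" by (rule prob_space_PiM) (rule M)
  interpret u: prob_space "M u" by (rule M)
  interpret pair_sigma_finite "M u" "PiM UNIV M" ..
  have [measurable]: "(\<lambda>(x, \<xi>). \<xi>(u := x)) \<in> measurable (M u \<Otimes>\<^sub>M PiM UNIV M) (PiM UNIV M)"
    using measurable_add_dim[of u UNIV M, THEN measurable_pair_swap] 
    by (simp add: case_prod_unfold)
  have "(\<integral>\<^sup>+\<xi>. f \<xi> \<partial>PiM UNIV M)
      = (\<integral>\<^sup>+\<xi>. f \<xi> \<partial>distr (M u \<Otimes>\<^sub>M PiM UNIV M) (PiM UNIV M) (\<lambda>(x, \<xi>). \<xi>(u := x)))"
    using distr_pair_PiM_eq_PiM[of UNIV M u] M by simp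
  also have "\<dots> = (\<integral>\<^sup>+z. f ((\<lambda>(x, \<xi>). \<xi>(u := x)) z) \<partial>(M u \<Otimes>\<^sub>M PiM UNIV M))"
    by (rule nn_integral_distr) measurable
  also have "\<dots> = (\<integral>\<^sup>+\<xi>. (\<integral>\<^sup>+x. f (\<xi>(u := x)) \<partial>M u) \<partial>PiM UNIV M)"
    by (subst nn_integral_snd[symmetric]) simp_all
  finally show ?thesis .
qed

text \<open>
  Independence of one coordinate from a function that ignores it. It follows by
  resampling that coordinate.
\<close>

lemma nn_integral_PiM_coordinate:
  fixes M :: "'i \<Rightarrow> 'a measure" and g :: "('i \<Rightarrow> 'a) \<Rightarrow> ennreal" and \<phi> :: "'a \<Rightarrow> ennreal"
  assumes M: "\<And>i. prob_space (M i)"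
    and [measurable]: "g \<in> borel_measurable (PiM UNIV M)" "\<phi> \<in> borel_measurable (M u)"
    and g: "\<And>\<xi> x. g (\<xi>(u := x)) = g \<xi>"
  shows "(\<integral>\<^sup>+\<xi>. g \<xi> * \<phi> (\<xi> u) \<partial>PiM UNIV M) = (\<integral>\<^sup>+\<xi>. g \<xi> \<partial>PiM UNIV M) * (\<integral>\<^sup>+x. \<phi> x \<partial>M u)"
proof -
  have "(\<integral>\<^sup>+\<xi>. g \<xi> * \<phi> (\<xi> u) \<partial>PiM UNIV M) = (\<integral>\<^sup>+\<xi>. (\<integral>\<^sup>+x. g \<xi> * \<phi> x \<partial>M u) \<partial>PiM UNIV M)"
    by (subst nn_integral_PiM_resample[OF M, where u = u]) (simp_all add: g)
  also have "\<dots> = (\<integral>\<^sup>+\<xi>. g \<xi> * (\<integral>\<^sup>+x. \<phi> x \<partial>M u) \<partial>PiM UNIV M)"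
    by (intro nn_integral_cong nn_integral_cmult) simp
  also have "\<dots> = (\<integral>\<^sup>+\<xi>. g \<xi> \<partial>PiM UNIV M) * (\<integral>\<^sup>+x. \<phi> x \<partial>M u)"
    by (rule nn_integral_multc) simp
  finally show ?thesis .
qed

abbreviation offspring_space :: "nat pmf \<Rightarrow> (vertex \<Rightarrow> nat) measure" where
  "offspring_space \<mu> \<equiv> \<Pi>\<^sub>M u\<in>UNIV. measure_pmf \<mu>"

abbreviation generation :: "(vertex \<Rightarrow> nat) \<Rightarrow> nat \<Rightarrow> vertex set" where
  "generation \<xi> n \<equiv> level (tree_of_offspring \<xi>) n"

lemma measurable_generation [measurable]: "Measurable.pred (offspring_space \<mu>) (\<lambda>\<xi>. u \<in> generation \<xi> n)"
  unfolding level_def tree_of_offspring_def by simp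

text \<open>
  Membership in generation \<open>n\<close> only looks at the offspring numbers of shorter words. This is the
  source of all independence used below.
\<close>

lemma generation_upd:
  "u \<in> generation (\<xi>(w := x)) (length w) \<longleftrightarrow> u \<in> generation \<xi> (length w)"
proof (cases "length u = length w")
  case True
  have "(\<xi>(w := x)) (take k u) = \<xi> (take k u)" if "k < length u" for k
  proof -
    have "length (take k u) \<noteq> length w" using that True by simp
    then have "take k u \<noteq> w" by blast
    then show ?thesis by (rule fun_upd_other)
  qed
  then have "(\<forall>k<length u. u ! k < (\<xi>(w := x)) (take k u)) \<longleftrightarrow> (\<forall>k<length u. u ! k < \<xi> (take k u))"
    by metis
  then show ?thesis unfolding level_def tree_of_offspring_def mem_Collect_eq by (rule arg_cong)
qed (simp add: level_def)

lemma snoc_in_tree_of_offspring: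
  "u @ [i] \<in> tree_of_offspring \<xi> \<longleftrightarrow> u \<in> tree_of_offspring \<xi> \<and> i < \<xi> u"
  by (auto simp: tree_of_offspring_def nth_append less_Suc_eq)

lemma finite_generation: "finite (generation \<xi> n)"
  by (rule finite_level) (rule plane_tree_tree_of_offspring)

lemma card_generation_Suc: "card (generation \<xi> (Suc n)) = (\<Sum>u\<in>generation \<xi> n. \<xi> u)"
proof -
  have "generation \<xi> (Suc n) = (\<Union>u\<in>generation \<xi> n. (\<lambda>i. u @ [i]) ` {..<\<xi> u})"
  proof (intro set_eqI iffI)
    fix w assume w: "w \<in> generation \<xi> (Suc n)"
    then obtain u i where "w = u @ [i]" by (cases w rule: rev_cases) (auto simp: level_def)
    then show "w \<in> (\<Union>u\<in>generation \<xi> n. (\<lambda>i. u @ [i]) ` {..<\<xi> u})"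
      using w by (auto simp: level_def snoc_in_tree_of_offspring)
  qed (auto simp: level_def snoc_in_tree_of_offspring)
  also have "card \<dots> = (\<Sum>u\<in>generation \<xi> n. card ((\<lambda>i. u @ [i]) ` {..<\<xi> u}))"
    by (rule card_UN_disjoint) (auto simp: finite_generation)
  also have "\<dots> = (\<Sum>u\<in>generation \<xi> n. \<xi> u)"
    by (intro sum.cong refl) (simp add: card_image inj_on_def)
  finally show ?thesis .
qed

text \<open>
  The sums over a random generation are written as integrals over all words against this indicator,
  so that Fubini's theorem for countable sums applies.
\<close>

abbreviation in_gen :: "nat \<Rightarrow> vertex \<Rightarrow> (vertex \<Rightarrow> nat) \<Rightarrow> ennreal" where
  "in_gen n u \<xi> \<equiv> indicator (generation \<xi> n) u"

lemma measurable_in_gen [measurable]: "in_gen n u \<in> borel_measurable (offspring_space \<mu>)"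
proof -
  have "in_gen n u = (\<lambda>\<xi>. if u \<in> generation \<xi> n then 1 else 0)" by (auto simp: indicator_def)
  then show ?thesis by simp
qed

lemma nn_integral_in_gen:
  fixes h :: "vertex \<Rightarrow> ennreal"
  shows
  "(\<integral>\<^sup>+u. in_gen n u \<xi> * h u \<partial>count_space UNIV) = (\<Sum>u\<in>generation \<xi> n. h u)"
  by (subst mult.commute)
    (simp add: nn_integral_count_space_indicator[symmetric] nn_integral_count_space_finite finite_generation)

lemma card_generation_Suc_eq_nn_integral:
  "of_nat (card (generation \<xi> (Suc n))) = (\<integral>\<^sup>+u. in_gen n u \<xi> * of_nat (\<xi> u) \<partial>count_space UNIV)"
  by (simp add: card_generation_Suc nn_integral_in_gen)

lemma card_generation_eq_nn_integral:
  "of_nat (card (generation \<xi> n)) = (\<integral>\<^sup>+u. in_gen n u \<xi> \<partial>count_space UNIV)"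
  using nn_integral_in_gen[where h = "\<lambda>_. 1" and n = n and \<xi> = \<xi>] by (simp add: finite_generation)

lemma prob_space_offspring_space: "prob_space (offspring_space \<mu>)"
  by (rule prob_space_PiM) (rule prob_space_measure_pmf)

lemma nn_integral_in_gen_offspring:
  fixes g :: "(vertex \<Rightarrow> nat) \<Rightarrow> ennreal" and \<phi> :: "nat \<Rightarrow> ennreal"
  assumes [measurable]: "g \<in> borel_measurable (offspring_space \<mu>)" and g: "\<And>\<xi> x. g (\<xi>(u := x)) = g \<xi>"
  shows "(\<integral>\<^sup>+\<xi>. g \<xi> * \<phi> (\<xi> u) \<partial>offspring_space \<mu>) = (\<integral>\<^sup>+\<xi>. g \<xi> \<partial>offspring_space \<mu>) * (\<integral>\<^sup>+k. \<phi> k \<partial>measure_pmf \<mu>)"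
  by (rule nn_integral_PiM_coordinate[where M = "\<lambda>_. measure_pmf \<mu>" and g = g and \<phi> = \<phi> and u = u])
    (simp_all add: prob_space_measure_pmf g)

lemma measurable_offspring [measurable]: "(\<lambda>\<xi>. of_nat (\<xi> u) :: ennreal) \<in> borel_measurable (offspring_space \<mu>)"
  by (rule measurable_compose[OF measurable_component_singleton[of u UNIV "\<lambda>_. measure_pmf \<mu>"]])
    simp_all

lemma in_gen_upd: "length w = n \<Longrightarrow> in_gen n u (\<xi>(w := x)) = in_gen n u \<xi>"
  using generation_upd[of u \<xi> w x] by (simp add: indicator_def)

lemma in_gen_eq_0: "length u \<noteq> n \<Longrightarrow> in_gen n u \<xi> = 0"
  by (simp add: level_def)

text \<open>
  The offspring number of \<open>u\<close> is independent of the event that \<open>u\<close> belongs to the tree and has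
  mean \<open>1\<close>.
\<close>

lemma nn_integral_card_generation:
  assumes mean: "(\<integral>\<^sup>+k. of_nat k \<partial>measure_pmf \<mu>) = 1"
  shows "(\<integral>\<^sup>+\<xi>. of_nat (card (generation \<xi> n)) \<partial>offspring_space \<mu>) = 1"
proof (induction n)
  case 0
  have "generation \<xi> 0 = {[]}" for \<xi>
    by (auto simp: level_def tree_of_offspring_def)
  then show ?case by (simp add: prob_space.emeasure_space_1[OF prob_space_offspring_space])
next
  case (Suc n)
  have "(\<integral>\<^sup>+\<xi>. of_nat (card (generation \<xi> (Suc n))) \<partial>offspring_space \<mu>)
      = (\<integral>\<^sup>+u. \<integral>\<^sup>+\<xi>. in_gen n u \<xi> * of_nat (\<xi> u) \<partial>offspring_space \<mu> \<partial>count_space UNIV)"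
    unfolding card_generation_Suc_eq_nn_integral
    by (rule nn_integral_count_space_nn_integral) measurable
  also have "\<dots> = (\<integral>\<^sup>+u. \<integral>\<^sup>+\<xi>. in_gen n u \<xi> \<partial>offspring_space \<mu> \<partial>count_space UNIV)"
  proof (rule nn_integral_cong)
    fix u
    show "(\<integral>\<^sup>+\<xi>. in_gen n u \<xi> * of_nat (\<xi> u) \<partial>offspring_space \<mu>) = (\<integral>\<^sup>+\<xi>. in_gen n u \<xi> \<partial>offspring_space \<mu>)"
    proof (cases "length u = n")
      case True
      then show ?thesis
        using nn_integral_in_gen_offspring[of "in_gen n u" \<mu> u of_nat] by (simp add: in_gen_upd mean)
    qed (simp add: in_gen_eq_0)
  qed
  also have "\<dots> = (\<integral>\<^sup>+\<xi>. of_nat (card (generation \<xi> n)) \<partial>offspring_space \<mu>)"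
    unfolding card_generation_eq_nn_integral
    by (rule nn_integral_count_space_nn_integral[symmetric]) (simp_all add: measurable_in_gen)
  finally show ?case using Suc by simp
qed

lemma borel_measurable_nn_integral_count_space:
  fixes a :: "'i :: countable \<Rightarrow> 'a \<Rightarrow> ennreal"
  assumes [measurable]: "\<And>i. a i \<in> borel_measurable M"
  shows "(\<lambda>x. \<integral>\<^sup>+i. a i x \<partial>count_space UNIV) \<in> borel_measurable M"
proof -
  interpret sigma_finite_measure "count_space (UNIV :: 'i set)"
    by (rule sigma_finite_measure_count_space_countable) simp
  have "(\<lambda>(i, x). a i x) \<in> borel_measurable (count_space UNIV \<Otimes>\<^sub>M M)"
    by (rule measurable_pair_measure_countable1) simp_all
  then show ?thesis
    by (intro borel_measurable_nn_integral) (simp add: measurable_pair_swap_iff[of _ M] case_prod_unfold)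
qed

text \<open>
  Expand the square of the size of generation \<open>n + 1\<close> into a sum over pairs \<open>u, v\<close> of generation \<open>n\<close>
  of products of their offspring numbers. For \<open>u \<noteq> v\<close> the two numbers are independent of each other
  and of the tree up to generation \<open>n\<close>, and contribute a factor \<open>1\<close>; the diagonal contributes a factor
  \<open>m\<close>. So one generation adds at most \<open>m\<close> times the mean size, which is \<open>1\<close>.
\<close>

lemma nn_integral_card_generation_sq:
  assumes mean: "(\<integral>\<^sup>+k. of_nat k \<partial>measure_pmf \<mu>) = 1"
  defines "m \<equiv> (\<integral>\<^sup>+k. (of_nat k)\<^sup>2 \<partial>measure_pmf \<mu>)"
  shows "(\<integral>\<^sup>+\<xi>. (of_nat (card (generation \<xi> n)))\<^sup>2 \<partial>offspring_space \<mu>) \<le> 1 + of_nat n * m"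
proof (induction n)
  case 0
  have "generation \<xi> 0 = {[]}" for \<xi>
    by (auto simp: level_def tree_of_offspring_def)
  then show ?case by (simp add: prob_space.emeasure_space_1[OF prob_space_offspring_space])
next
  case (Suc n)
  have pair: "(\<integral>\<^sup>+\<xi>. (\<integral>\<^sup>+u. a u \<xi> \<partial>count_space UNIV)\<^sup>2 \<partial>offspring_space \<mu>)
      = (\<integral>\<^sup>+u. \<integral>\<^sup>+v. \<integral>\<^sup>+\<xi>. a u \<xi> * a v \<xi> \<partial>offspring_space \<mu> \<partial>count_space UNIV \<partial>count_space UNIV)"
    if [measurable]: "\<And>u. a u \<in> borel_measurable (offspring_space \<mu>)" for a :: "vertex \<Rightarrow> (vertex \<Rightarrow> nat) \<Rightarrow> ennreal"
  proof -
    have [measurable]: "(\<lambda>\<xi>. \<integral>\<^sup>+v. a v \<xi> \<partial>count_space UNIV) \<in> borel_measurable (offspring_space \<mu>)"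
      by (rule borel_measurable_nn_integral_count_space) (rule that)
    have "(\<integral>\<^sup>+u. a u \<xi> \<partial>count_space UNIV)\<^sup>2
       = (\<integral>\<^sup>+u. \<integral>\<^sup>+v. a u \<xi> * a v \<xi> \<partial>count_space UNIV \<partial>count_space UNIV)" for \<xi>
      by (simp add: power2_eq_square nn_integral_cmult nn_integral_multc)
    then have "(\<integral>\<^sup>+\<xi>. (\<integral>\<^sup>+u. a u \<xi> \<partial>count_space UNIV)\<^sup>2 \<partial>offspring_space \<mu>)
      = (\<integral>\<^sup>+\<xi>. \<integral>\<^sup>+u. \<integral>\<^sup>+v. a u \<xi> * a v \<xi> \<partial>count_space UNIV \<partial>count_space UNIV \<partial>offspring_space \<mu>)"
      by simp
    also have "\<dots> = (\<integral>\<^sup>+u. \<integral>\<^sup>+\<xi>. \<integral>\<^sup>+v. a u \<xi> * a v \<xi> \<partial>count_space UNIV \<partial>offspring_space \<mu> \<partial>count_space UNIV)"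
      by (rule nn_integral_count_space_nn_integral)
        (simp_all add: nn_integral_cmult)
    also have "\<dots> = (\<integral>\<^sup>+u. \<integral>\<^sup>+v. \<integral>\<^sup>+\<xi>. a u \<xi> * a v \<xi> \<partial>offspring_space \<mu> \<partial>count_space UNIV \<partial>count_space UNIV)"
      by (intro nn_integral_cong nn_integral_count_space_nn_integral) simp_all
    finally show ?thesis .
  qed
  have bound: "(\<integral>\<^sup>+\<xi>. (in_gen n u \<xi> * of_nat (\<xi> u)) * (in_gen n v \<xi> * of_nat (\<xi> v)) \<partial>offspring_space \<mu>)
      \<le> (\<integral>\<^sup>+\<xi>. in_gen n u \<xi> * in_gen n v \<xi> \<partial>offspring_space \<mu>) + m * (\<integral>\<^sup>+\<xi>. in_gen n u \<xi> \<partial>offspring_space \<mu>) * indicator {u} v" for u v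
  proof -
    consider "length u \<noteq> n \<or> length v \<noteq> n" | "length u = n" "length v = n" "u \<noteq> v" | "length u = n" "u = v"
      by blast
    then show ?thesis
    proof cases
      case 1
      then show ?thesis by (auto simp: in_gen_eq_0)
    next
      case 2
      have "(\<integral>\<^sup>+\<xi>. (in_gen n u \<xi> * of_nat (\<xi> u)) * (in_gen n v \<xi> * of_nat (\<xi> v)) \<partial>offspring_space \<mu>)
          = (\<integral>\<^sup>+\<xi>. (in_gen n u \<xi> * in_gen n v \<xi> * of_nat (\<xi> u)) * of_nat (\<xi> v) \<partial>offspring_space \<mu>)"
        by (simp add: mult_ac)
      also have "\<dots> = (\<integral>\<^sup>+\<xi>. in_gen n u \<xi> * in_gen n v \<xi> * of_nat (\<xi> u) \<partial>offspring_space \<mu>)"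
        using 2 nn_integral_in_gen_offspring[of "\<lambda>\<xi>. in_gen n u \<xi> * in_gen n v \<xi> * of_nat (\<xi> u)" \<mu> v of_nat]
        by (simp add: in_gen_upd mean)
      also have "\<dots> = (\<integral>\<^sup>+\<xi>. in_gen n u \<xi> * in_gen n v \<xi> \<partial>offspring_space \<mu>)"
        using 2 nn_integral_in_gen_offspring[of "\<lambda>\<xi>. in_gen n u \<xi> * in_gen n v \<xi>" \<mu> u of_nat]
        by (simp add: in_gen_upd mean)
      finally show ?thesis by simp
    next
      case 3
      have "(\<integral>\<^sup>+\<xi>. (in_gen n u \<xi> * of_nat (\<xi> u)) * (in_gen n v \<xi> * of_nat (\<xi> v)) \<partial>offspring_space \<mu>)
          = (\<integral>\<^sup>+\<xi>. in_gen n u \<xi> * (of_nat (\<xi> u))\<^sup>2 \<partial>offspring_space \<mu>)"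
        using 3 by (intro nn_integral_cong) (simp add: indicator_def power2_eq_square)
      also have "\<dots> = (\<integral>\<^sup>+\<xi>. in_gen n u \<xi> \<partial>offspring_space \<mu>) * m"
        unfolding m_def using 3 nn_integral_in_gen_offspring[of "in_gen n u" \<mu> u "\<lambda>k. (of_nat k)\<^sup>2"]
        by (simp add: in_gen_upd)
      finally have eq: "(\<integral>\<^sup>+\<xi>. (in_gen n u \<xi> * of_nat (\<xi> u)) * (in_gen n v \<xi> * of_nat (\<xi> v)) \<partial>offspring_space \<mu>)
          = (\<integral>\<^sup>+\<xi>. in_gen n u \<xi> \<partial>offspring_space \<mu>) * m" .
      have "y * m \<le> x + m * y * indicator {u} v" for x y :: ennreal
        using 3 by (simp add: mult.commute)
      then show ?thesis unfolding eq .
    qed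
  qed
  have "(\<integral>\<^sup>+\<xi>. (of_nat (card (generation \<xi> (Suc n))))\<^sup>2 \<partial>offspring_space \<mu>)
      = (\<integral>\<^sup>+u. \<integral>\<^sup>+v. \<integral>\<^sup>+\<xi>. (in_gen n u \<xi> * of_nat (\<xi> u)) * (in_gen n v \<xi> * of_nat (\<xi> v)) \<partial>offspring_space \<mu>
            \<partial>count_space UNIV \<partial>count_space UNIV)"
    unfolding card_generation_Suc_eq_nn_integral by (rule pair) measurable
  also have "\<dots> \<le> (\<integral>\<^sup>+u. \<integral>\<^sup>+v. (\<integral>\<^sup>+\<xi>. in_gen n u \<xi> * in_gen n v \<xi> \<partial>offspring_space \<mu>)
      + m * (\<integral>\<^sup>+\<xi>. in_gen n u \<xi> \<partial>offspring_space \<mu>) * indicator {u} v \<partial>count_space UNIV \<partial>count_space UNIV)"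
    by (intro nn_integral_mono bound)
  also have "\<dots> = (\<integral>\<^sup>+u. \<integral>\<^sup>+v. \<integral>\<^sup>+\<xi>. in_gen n u \<xi> * in_gen n v \<xi> \<partial>offspring_space \<mu> \<partial>count_space UNIV \<partial>count_space UNIV)
      + m * (\<integral>\<^sup>+u. \<integral>\<^sup>+\<xi>. in_gen n u \<xi> \<partial>offspring_space \<mu> \<partial>count_space UNIV)"
    by (simp add: nn_integral_add nn_integral_cmult)
  also have "(\<integral>\<^sup>+u. \<integral>\<^sup>+v. \<integral>\<^sup>+\<xi>. in_gen n u \<xi> * in_gen n v \<xi> \<partial>offspring_space \<mu> \<partial>count_space UNIV \<partial>count_space UNIV)
      = (\<integral>\<^sup>+\<xi>. (of_nat (card (generation \<xi> n)))\<^sup>2 \<partial>offspring_space \<mu>)"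
    unfolding card_generation_eq_nn_integral by (rule pair[symmetric], rule measurable_in_gen)
  also have "(\<integral>\<^sup>+u. \<integral>\<^sup>+\<xi>. in_gen n u \<xi> \<partial>offspring_space \<mu> \<partial>count_space UNIV)
      = (\<integral>\<^sup>+\<xi>. of_nat (card (generation \<xi> n)) \<partial>offspring_space \<mu>)"
    unfolding card_generation_eq_nn_integral
    by (rule nn_integral_count_space_nn_integral[symmetric]) (simp_all add: measurable_in_gen)
  also have "\<dots> = 1" by (rule nn_integral_card_generation[OF mean])
  also have "(\<integral>\<^sup>+\<xi>. (of_nat (card (generation \<xi> n)))\<^sup>2 \<partial>offspring_space \<mu>) + m * 1 \<le> (1 + of_nat n * m) + m * 1"
    using Suc by (rule add_right_mono)
  finally show ?case by (simp add: algebra_simps)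
qed

section \<open>Causal maps\<close>

text \<open>
  Every edge carries one arc per value of the flag, so flipping the flag reverses arcs without fixed
  points, even on loops.
\<close>

lemma bidirected_digraph_Causal:
  assumes "plane_tree t"
  shows "bidirected_digraph (Causal t) (\<lambda>a. if a \<in> arcs (Causal t) then (fst a, \<not> snd a) else a)"
proof -
  interpret wf_digraph "Causal t" by (rule wf_digraph_Causal) fact
  show ?thesis
    by (rule bidirected_digraphI) (auto simp: Causal_def)
qed

text \<open>
  The layers are the levels of the tree. Horizontal edges stay within a level, and the arcs from level
  \<open>k\<close> to level \<open>k + 1\<close> correspond to the vertices of level \<open>k + 1\<close>, through the edge to the parent.
\<close>

lemma recurrent_Causal:
  assumes t: "plane_tree t"
    and div: "\<not> summable (\<lambda>k. 1 / real (card (level t (Suc k))))"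
  shows "recurrent (Causal t)"
proof (rule recurrent_if_sum_inverse_layers_diverges[where l = length])
  show "bidirected_digraph (Causal t) (\<lambda>a. if a \<in> arcs (Causal t) then (fst a, \<not> snd a) else a)"
    by (rule bidirected_digraph_Causal[OF t])
  show "finite (out_arcs (Causal t) x)" for x by (rule finite_out_arcs_Causal[OF t])
  show "out_arcs (Causal t) x \<noteq> {}" if "x \<in> verts (Causal t)" for x
    using that by (intro out_arcs_Causal_nonempty) (simp add: Causal_def)
  show "finite {x \<in> verts (Causal t). length x = k}" for k
    using finite_level[OF t, of k] by (simp add: Causal_def level_def)
  have next_length: "length (next_in_level t u) = length u" if "u \<in> t" for u
    using next_in_level_in_level[OF t that] by (simp add: level_def)
  show "length (head (Causal t) a) \<le> Suc (length (tail (Causal t) a))" if "a \<in> arcs (Causal t)" for a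
    using that by (auto simp: Causal_def causal_edges_def next_length split: if_splits)
  have "{a \<in> arcs (Causal t). length (tail (Causal t) a) = k \<and> length (head (Causal t) a) = Suc k}
      = (\<lambda>u. (Tree_edge u, False)) ` level t (Suc k)" for k
    by (auto simp: Causal_def causal_edges_def level_def next_length split: if_splits)
  then have "card {a \<in> arcs (Causal t). length (tail (Causal t) a) = k \<and> length (head (Causal t) a) = Suc k}
      = card (level t (Suc k))" for k
    by (simp add: card_image inj_on_def)
  then show "\<not> summable (\<lambda>k. 1 / real (card {a \<in> arcs (Causal t).
      length (tail (Causal t) a) = k \<and> length (head (Causal t) a) = Suc k}))"
    using div by simp
qed

lemma take_in_plane_tree:
  assumes "plane_tree t" "u \<in> t"
  shows "take k u \<in> t"
  using assms(2)
proof (induction u rule: rev_induct)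
  case (snoc i u)
  then have "u \<in> t" using assms(1) unfolding plane_tree_def by blast
  with snoc show ?case by (cases "k \<le> length u") auto
qed simp

lemma level_nonempty_if_infinite:
  assumes t: "plane_tree t" and "infinite t"
  shows "level t k \<noteq> {}"
proof
  assume empty: "level t k = {}"
  have "t \<subseteq> (\<Union>j<k. level t j)"
  proof
    fix u assume u: "u \<in> t"
    have "length u < k"
    proof (rule ccontr)
      assume "\<not> length u < k"
      then have "take k u \<in> level t k" using take_in_plane_tree[OF t u] by (simp add: level_def)
      with empty show False by simp
    qed
    with u show "u \<in> (\<Union>j<k. level t j)" by (auto simp: level_def)
  qed
  then have "finite t" by (rule finite_subset) (simp add: finite_level[OF t])
  with \<open>infinite t\<close> show False by simp
qed

lemma finite_truncate_tree:
  assumes "plane_tree t"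
  shows "finite (truncate_tree n t)"
proof -
  have "truncate_tree n t = (\<Union>k\<le>n. level t k)" by (auto simp: truncate_tree_def level_def)
  then show ?thesis by (simp add: finite_level[OF assms])
qed

lemma level_truncate_tree: "level (truncate_tree n t) n = level t n"
  by (auto simp: truncate_tree_def level_def)

lemma space_plane_tree_space: "space plane_tree_space = {t. plane_tree t}"
  unfolding plane_tree_space_def by (rule space_measure_of) auto

text \<open>
  The size of level \<open>n\<close> is a function of the truncation at height \<open>n\<close>, which takes countably many
  values, and the events that prescribe a truncation generate the \<open>\<sigma>\<close>-algebra.
\<close>

lemma measurable_card_level [measurable]:
  "(\<lambda>t. card (level t n)) \<in> measurable plane_tree_space (count_space UNIV)"
  unfolding measurable_count_space_eq2_countable
proof (intro conjI ballI)
  fix k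
  define S where "S = {s :: vertex set. finite s \<and> card (level s n) = k}"
  have "S \<subseteq> {s. finite s \<and> s \<subseteq> UNIV}" by (auto simp: S_def)
  then have "countable S" by (rule countable_subset) (rule countable_Collect_finite_subset, simp)
  have "(\<lambda>t. card (level t n)) -` {k} \<inter> space plane_tree_space
      = (\<Union>s\<in>S. {t. plane_tree t \<and> truncate_tree n t = s})"
    using finite_truncate_tree by (auto simp: S_def space_plane_tree_space level_truncate_tree)
  also have "\<dots> \<in> sets plane_tree_space"
  proof (rule sets.countable_UN'[OF \<open>countable S\<close>], rule image_subsetI)
    show "{t. plane_tree t \<and> truncate_tree n t = s} \<in> sets plane_tree_space" for s
      unfolding plane_tree_space_def by (subst sets_measure_of) (auto intro!: sigma_sets.Basic)
  qed
  finally show "(\<lambda>t. card (level t n)) -` {k} \<inter> space plane_tree_space \<in> sets plane_tree_space" .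
qed auto

text \<open>
  The size-biasing in the law of the conditioned tree turns the mean of a level size into the second
  moment of the corresponding level of the unconditioned tree.
\<close>

lemma nn_integral_card_level_conditioned:
  assumes T: "gw_conditioned_to_survive \<mu> M T"
    and mean: "(\<integral>\<^sup>+k. of_nat k \<partial>measure_pmf \<mu>) = 1"
  shows "(\<integral>\<^sup>+\<omega>. of_nat (card (level (T \<omega>) n)) \<partial>M) \<le> 1 + of_nat n * (\<integral>\<^sup>+k. (of_nat k)\<^sup>2 \<partial>measure_pmf \<mu>)"
proof -
  let ?F = "\<lambda>s. of_nat (card (level s n)) :: ennreal"
  have "(\<integral>\<^sup>+\<omega>. ?F (T \<omega>) \<partial>M) = (\<integral>\<^sup>+\<omega>. ?F (truncate_tree n (T \<omega>)) \<partial>M)"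
    by (simp add: level_truncate_tree)
  also have "\<dots> = (\<integral>\<^sup>+t. ?F (truncate_tree n t) * of_nat (card (level t n)) \<partial>galton_watson \<mu>)"
    using T unfolding gw_conditioned_to_survive_def by (elim conjE allE[of _ n] allE[of _ ?F])
  also have "\<dots> = (\<integral>\<^sup>+t. (?F t)\<^sup>2 \<partial>galton_watson \<mu>)"
    by (simp add: level_truncate_tree power2_eq_square)
  also have "\<dots> = (\<integral>\<^sup>+\<xi>. (?F (tree_of_offspring \<xi>))\<^sup>2 \<partial>offspring_space \<mu>)"
    unfolding galton_watson_def
    by (rule nn_integral_distr[OF measurable_tree_of_offspring])
      (subst measurable_distr_eq1, rule measurable_compose[OF measurable_card_level], simp)
  also have "\<dots> \<le> 1 + of_nat n * (\<integral>\<^sup>+k. (of_nat k)\<^sup>2 \<partial>measure_pmf \<mu>)"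
    by (rule nn_integral_card_generation_sq[OF mean])
  finally show ?thesis .
qed

theorem proposition4:
  fixes \<mu> :: "nat pmf" and M :: "'w measure" and T :: "'w \<Rightarrow> vertex set"
  assumes "integrable (measure_pmf \<mu>) real"
    and "measure_pmf.expectation \<mu> real = 1"
    and "integrable (measure_pmf \<mu>) (\<lambda>k. (real k)\<^sup>2)"
    and "measure_pmf.variance \<mu> real \<noteq> 0"
    and "prob_space M"
    and "gw_conditioned_to_survive \<mu> M T"
  shows "AE \<omega> in M. recurrent (Causal (T \<omega>))"
proof -
  interpret prob_space M by fact
  have T [measurable]: "T \<in> measurable M plane_tree_space"
    and inf: "AE \<omega> in M. infinite (T \<omega>)"
    using assms(6) by (auto simp: gw_conditioned_to_survive_def)
  have tree: "plane_tree (T \<omega>)" if "\<omega> \<in> space M" for \<omega>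
    using measurable_space[OF T that] by (simp add: space_plane_tree_space)
  define X where "X n \<omega> = real (card (level (T \<omega>) (Suc n)))" for n \<omega>
  define m where "m = measure_pmf.expectation \<mu> (\<lambda>k. (real k)\<^sup>2)"
  have m: "m \<ge> 0" unfolding m_def by (rule integral_nonneg_AE) simp
  have mean: "(\<integral>\<^sup>+k. of_nat k \<partial>measure_pmf \<mu>) = 1"
    using nn_integral_eq_integral[OF assms(1)] assms(2) by (simp add: ennreal_of_nat_eq_real_of_nat)
  have sq: "(\<integral>\<^sup>+k. (of_nat k)\<^sup>2 \<partial>measure_pmf \<mu>) = ennreal m"
    using nn_integral_eq_integral[OF assms(3)]
    by (simp add: m_def ennreal_of_nat_eq_real_of_nat ennreal_power)
  have [measurable]: "X n \<in> borel_measurable M" for n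
  proof -
    have "(\<lambda>\<omega>. card (level (T \<omega>) (Suc n))) \<in> measurable M (count_space UNIV)"
      by (rule measurable_compose[OF T measurable_card_level])
    then show ?thesis unfolding X_def by (rule measurable_compose) simp
  qed
  have nn_X: "(\<integral>\<^sup>+\<omega>. ennreal (X n \<omega>) \<partial>M) \<le> ennreal ((1 + m) * Suc n)" for n
  proof -
    have "(\<integral>\<^sup>+\<omega>. ennreal (X n \<omega>) \<partial>M) \<le> 1 + of_nat (Suc n) * ennreal m"
      using nn_integral_card_level_conditioned[OF assms(6) mean, of "Suc n", unfolded sq]
      unfolding X_def ennreal_of_nat_eq_real_of_nat .
    also have "\<dots> = ennreal (1 + real (Suc n) * m)"
      using m by (simp add: ennreal_of_nat_eq_real_of_nat ennreal_mult ennreal_plus del: of_nat_Suc)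
    also have "\<dots> \<le> ennreal ((1 + m) * Suc n)"
      by (rule ennreal_leI) (simp add: algebra_simps)
    finally show ?thesis .
  qed
  have int: "integrable M (X n)" for n
    unfolding integrable_iff_bounded using le_less_trans[OF nn_X[of n]] by (simp add: X_def)
  have "AE \<omega> in M. \<not> summable (\<lambda>n. 1 / X n \<omega>)"
  proof (rule AE_not_summable_inverse[where b = "\<lambda>n. (1 + m) * Suc n", OF int])
    show "AE \<omega> in M. \<forall>n. 0 < X n \<omega>"
      using inf AE_space
    proof eventually_elim
      case (elim \<omega>)
      then have "level (T \<omega>) (Suc n) \<noteq> {}" for n
        by (intro level_nonempty_if_infinite tree)
      then show ?case
        using finite_level[OF tree] elim by (simp add: X_def card_gt_0_iff)
    qed
    show "expectation (X n) \<le> (1 + m) * Suc n" for n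
      using nn_X[of n] m nn_integral_eq_integral[OF int[of n]]
      by (simp add: X_def ennreal_le_iff del: of_nat_Suc)
    show "0 < (1 + m) * Suc n" for n using m by simp
    show "\<not> summable (\<lambda>n. 1 / ((1 + m) * real (Suc n)))"
    proof
      assume "summable (\<lambda>n. 1 / ((1 + m) * real (Suc n)))"
      then have "summable (\<lambda>n. (1 + m) * (1 / ((1 + m) * real (Suc n))))"
        by (rule summable_mult)
      moreover have "(1 + m) * (1 / ((1 + m) * real (Suc n))) = inverse (real (Suc n))" for n
        using m by (simp add: inverse_eq_divide del: of_nat_Suc)
      ultimately have "summable (\<lambda>n. inverse (real (Suc n)))" by (simp only:)
      then show False
        using not_summable_harmonic[where 'a = real] summable_Suc_iff[of "\<lambda>n. inverse (real n)"] by blast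
    qed
  qed
  with AE_space show ?thesis
  proof eventually_elim
    case (elim \<omega>)
    then show ?case
      by (intro recurrent_Causal tree) (simp_all add: X_def)
  qed
qed

end
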